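(* Let $r\ge 0$ and let $S\subseteq\{0,1,\ldots,r\}$ be a subset containing $r$. The filtered chain complex $Q_r\mathbb{S}$ is cofibrant in $(f\mathcal{C})_S$.
   Context: Fix a commutative unital ring $R$. $f\mathcal{C}$ is the category of filtered chain complexes: an object is an unbounded, cohomologically graded chain complex $A$ of $R$-modules (differential $d$ of degree $+1$) with subcomplexes $F_pA$, $p\in\mathbb{Z}$, such that $F_pA\subseteq F_{p+1}A\subseteq A$; a morphism is a chain map $f$ with $f(F_pA)\subseteq F_pB$ for all $p$. For $k\ge 0$ put $Z_k^{p,p+n}(A)=F_pA^n\cap d^{-1}F_{p-k}A^{n+1}$, $B_0^{p,p+n}(A)=F_{p-1}A^n$, and for $k\ge1$, $B_k^{p,p+n}(A)=d\,Z_{k-1}^{p+k-1,p+k-1+n-1}(A)+Z_{k-1}^{p-1,p-1+n}(A)$. The $k$-page is $E_k^{p,p+n}(A)=Z_k^{p,p+n}(A)/B_k^{p,p+n}(A)$. An $r$-quasi-isomorphism is a morphism inducing an isomorphism on $E_{r+1}$. $R_{(p)}^n$ is the filtered chain complex with a copy of $R$ in degree $n$ and $0$ elsewhere, with $F_q=0$ for $q<p$ and $F_q=R$ for $q\ge p$. Set $\mathcal{Z}_k(p,n)=\bigl(R_{(p)}^n\xrightarrow{1}R_{(p-k)}^{n+1}\bigr)$, and for $k\ge 1$, $\mathcal{B}_k(p,n)=\mathcal{Z}_{k-1}(p+k-1,n-1)\oplus\mathcal{Z}_{k-1}(p-1,n)$, with $\varphi_k\colon\mathcal{Z}_k(p,n)\to\mathcal{B}_k(p,n)$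 the diagonal $R_{(p)}^n\to R_{(p)}^n\oplus R_{(p-1)}^n$ in degree $n$ and the identity in degree $n+1$. Let $I_r=\{\varphi_{r+1}\colon\mathcal{Z}_{r+1}(p,n)\to\mathcal{B}_{r+1}(p,n)\}_{p,n\in\mathbb{Z}}$, $J_k=\{0\to\mathcal{Z}_k(p,n)\}_{p,n\in\mathbb{Z}}$, $I_S=I_r\cup\bigcup_{s\in S}J_s$, $J_S=\bigcup_{s\in S}J_s$. $(f\mathcal{C})_S$ is the cofibrantly generated model structure on $f\mathcal{C}$ with weak equivalences the $r$-quasi-isomorphisms, generating cofibrations $I_S$ and generating acyclic cofibrations $J_S$. $Q_r\mathbb{S}$ is the filtered chain complex $\bigoplus_{i\ge0}R_{(-i)}^0\to\bigoplus_{j\ge1}R_{(-r-j)}^1$ (degrees $0$ and $1$) with, writing $1_{(p)}^n$ for the generator of $R_{(p)}^n$, $d1_{(0)}^0=1_{(-r-1)}^1$ and $d1_{(-i)}^0=1_{(-i-r)}^1+1_{(-i-r-1)}^1$ for $i\ge1$. *)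

theory Defs
  imports "HOL-Algebra.Module" "HOL-Algebra.AbelCoset"
begin

section \<open>Filtered chain complexes\<close>

text \<open>Complexes are cohomologically graded over all integers: \<open>cdiff A n\<close> maps \<open>cobj A n\<close> to
  \<open>cobj A (n + 1)\<close>, and \<open>cfilt A p n\<close> is the degree \<open>n\<close> part of the subcomplex \<open>F\<^sub>p A\<close>. The
  filtration is neither assumed exhaustive nor Hausdorff nor bounded. The ring \<open>R\<close> may be zero.\<close>

record ('r, 'x) fcomplex =
  cobj :: "int \<Rightarrow> ('r, 'x) module"
  cdiff :: "int \<Rightarrow> 'x \<Rightarrow> 'x"
  cfilt :: "int \<Rightarrow> int \<Rightarrow> 'x set"

definition linear_maps ::
    "('r, 'e) ring_scheme \<Rightarrow> ('r, 'x) module \<Rightarrow> ('r, 'y) module \<Rightarrow> ('x \<Rightarrow> 'y) set" where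
  "linear_maps R M N =
     {f \<in> hom (add_monoid M) (add_monoid N).
        \<forall>a\<in>carrier R. \<forall>x\<in>carrier M. f (a \<odot>\<^bsub>M\<^esub> x) = a \<odot>\<^bsub>N\<^esub> f x}"

definition filtered_complex :: "('r, 'e) ring_scheme \<Rightarrow> ('r, 'x) fcomplex \<Rightarrow> bool" where
  "filtered_complex R A \<longleftrightarrow>
     (\<forall>n. module R (cobj A n)) \<and>
     (\<forall>n. cdiff A n \<in> linear_maps R (cobj A n) (cobj A (n + 1))) \<and>
     (\<forall>n. \<forall>x\<in>carrier (cobj A n). cdiff A (n + 1) (cdiff A n x) = \<zero>\<^bsub>cobj A (n + 2)\<^esub>) \<and>
     (\<forall>p n. submodule (cfilt A p n) R (cobj A n)) \<and>
     (\<forall>p n. cdiff A n ` cfilt A p n \<subseteq> cfilt A p (n + 1)) \<and>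
     (\<forall>p n. cfilt A p n \<subseteq> cfilt A (p + 1) n)"

definition fc_hom ::
    "('r, 'e) ring_scheme \<Rightarrow> ('r, 'x) fcomplex \<Rightarrow> ('r, 'y) fcomplex \<Rightarrow> (int \<Rightarrow> 'x \<Rightarrow> 'y) set" where
  "fc_hom R A B =
     {f. (\<forall>n. f n \<in> linear_maps R (cobj A n) (cobj B n)) \<and>
         (\<forall>n. \<forall>x\<in>carrier (cobj A n). f (n + 1) (cdiff A n x) = cdiff B n (f n x)) \<and>
         (\<forall>p n. f n ` cfilt A p n \<subseteq> cfilt B p n)}"

text \<open>A morphism together with its source and target.\<close>

type_synonym ('r, 'x, 'y) fmor = "('r, 'x) fcomplex \<times> ('r, 'y) fcomplex \<times> (int \<Rightarrow> 'x \<Rightarrow> 'y)"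

definition fc_morphism :: "('r, 'e) ring_scheme \<Rightarrow> ('r, 'x, 'y) fmor \<Rightarrow> bool" where
  "fc_morphism R = (\<lambda>(A, B, f). filtered_complex R A \<and> filtered_complex R B \<and> f \<in> fc_hom R A B)"


section \<open>Pages of the spectral sequence and weak equivalences\<close>

text \<open>In \<open>cycles\<close>, \<open>boundaries\<close> and \<open>page\<close> the arguments \<open>k p n\<close> stand for the lower index \<open>k\<close>
  and the bidegree \<open>(p, p + n)\<close>; thus \<open>n\<close> is the cohomological degree.\<close>

definition cycles :: "('r, 'x) fcomplex \<Rightarrow> nat \<Rightarrow> int \<Rightarrow> int \<Rightarrow> 'x set" where
  "cycles A k p n = {x \<in> cfilt A p n. cdiff A n x \<in> cfilt A (p - int k) (n + 1)}"

fun boundaries :: "('r, 'x) fcomplex \<Rightarrow> nat \<Rightarrow> int \<Rightarrow> int \<Rightarrow> 'x set" where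
  "boundaries A 0 p n = cfilt A (p - 1) n"
| "boundaries A (Suc k) p n =
     cdiff A (n - 1) ` cycles A k (p + int k) (n - 1) <+>\<^bsub>cobj A n\<^esub> cycles A k (p - 1) n"

text \<open>The underlying set of the quotient module of \<open>cycles\<close> by \<open>boundaries\<close>.\<close>

definition page :: "('r, 'x) fcomplex \<Rightarrow> nat \<Rightarrow> int \<Rightarrow> int \<Rightarrow> 'x set set" where
  "page A k p n = (\<lambda>x. boundaries A k p n +>\<^bsub>cobj A n\<^esub> x) ` cycles A k p n"

text \<open>The induced map sends the class of \<open>x\<close> to the class of \<open>f x\<close>; all members of the union below
  coincide.\<close>

definition page_map ::
    "('r, 'x, 'y) fmor \<Rightarrow> nat \<Rightarrow> int \<Rightarrow> int \<Rightarrow> 'x set \<Rightarrow> 'y set" where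
  "page_map = (\<lambda>(A, B, f) k p n c. \<Union>x\<in>c. boundaries B k p n +>\<^bsub>cobj B n\<^esub> f n x)"

text \<open>The induced maps are automatically linear, so they are isomorphisms if and only if they are
  bijective.\<close>

definition quasi_iso :: "('r, 'e) ring_scheme \<Rightarrow> nat \<Rightarrow> ('r, 'x, 'y) fmor \<Rightarrow> bool" where
  "quasi_iso R r = (\<lambda>(A, B, f). fc_morphism R (A, B, f) \<and>
     (\<forall>p n. bij_betw (page_map (A, B, f) (r + 1) p n) (page A (r + 1) p n) (page B (r + 1) p n)))"


section \<open>Lifting properties\<close>

text \<open>The map \<open>i\<close> has the left lifting property with respect to \<open>q\<close>. Morphisms are compared on
  carriers only.\<close>

definition lifts_against ::
    "('r, 'e) ring_scheme \<Rightarrow> ('r, 'a, 'b) fmor \<Rightarrow> ('r, 'x, 'y) fmor \<Rightarrow> bool" where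
  "lifts_against R = (\<lambda>(A, B, i) (X, Y, q).
     \<forall>u\<in>fc_hom R A X. \<forall>v\<in>fc_hom R B Y.
       (\<forall>n. \<forall>a\<in>carrier (cobj A n). q n (u n a) = v n (i n a)) \<longrightarrow>
       (\<exists>h\<in>fc_hom R B X.
          (\<forall>n. \<forall>a\<in>carrier (cobj A n). h n (i n a) = u n a) \<and>
          (\<forall>n. \<forall>b\<in>carrier (cobj B n). q n (h n b) = v n b)))"

text \<open>The class \<open>K-inj\<close> of morphisms with the right lifting property with respect to \<open>K\<close>.\<close>

definition injective_for ::
    "('r, 'e) ring_scheme \<Rightarrow> ('r, 'a, 'b) fmor set \<Rightarrow> ('r, 'x, 'y) fmor \<Rightarrow> bool" where
  "injective_for R K q \<longleftrightarrow> fc_morphism R q \<and> (\<forall>i\<in>K. lifts_against R i q)"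


section \<open>Generating (acyclic) cofibrations\<close>

text \<open>The free module of rank one if \<open>b\<close>, and the zero module otherwise. The ring multiplication
  fields of a \<open>module\<close> record play no role for modules.\<close>

definition rank_one :: "('r, 'e) ring_scheme \<Rightarrow> bool \<Rightarrow> ('r, 'r) module" where
  "rank_one R b = \<lparr>carrier = (if b then carrier R else {\<zero>\<^bsub>R\<^esub>}),
     mult = undefined, one = undefined,
     zero = \<zero>\<^bsub>R\<^esub>, add = add R, smult = mult R\<rparr>"

definition zero_complex :: "('r, 'e) ring_scheme \<Rightarrow> ('r, 'r) fcomplex" where
  "zero_complex R = \<lparr>cobj = (\<lambda>_. rank_one R False), cdiff = (\<lambda>_ _. \<zero>\<^bsub>R\<^esub>),
     cfilt = (\<lambda>_ _. {\<zero>\<^bsub>R\<^esub>})\<rparr>"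

definition from_zero :: "('r, 'e) ring_scheme \<Rightarrow> ('r, 'x) fcomplex \<Rightarrow> ('r, 'r, 'x) fmor" where
  "from_zero R A = (zero_complex R, A, (\<lambda>n _. \<zero>\<^bsub>cobj A n\<^esub>))"

definition Z_complex ::
    "('r, 'e) ring_scheme \<Rightarrow> nat \<Rightarrow> int \<Rightarrow> int \<Rightarrow> ('r, 'r) fcomplex" where
  "Z_complex R k p n =
     \<lparr>cobj = (\<lambda>m. rank_one R (m = n \<or> m = n + 1)),
      cdiff = (\<lambda>m x. if m = n then x else \<zero>\<^bsub>R\<^esub>),
      cfilt = (\<lambda>q m. if m = n \<and> p \<le> q \<or> m = n + 1 \<and> p - int k \<le> q
                      then carrier R else {\<zero>\<^bsub>R\<^esub>})\<rparr>"

definition module_sum :: "('r, 'x) module \<Rightarrow> ('r, 'y) module \<Rightarrow> ('r, 'x \<times> 'y) module" where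
  "module_sum M N = \<lparr>carrier = carrier M \<times> carrier N,
     mult = undefined, one = undefined,
     zero = (\<zero>\<^bsub>M\<^esub>, \<zero>\<^bsub>N\<^esub>),
     add = (\<lambda>(x, y) (x', y'). (x \<oplus>\<^bsub>M\<^esub> x', y \<oplus>\<^bsub>N\<^esub> y')),
     smult = (\<lambda>a (x, y). (a \<odot>\<^bsub>M\<^esub> x, a \<odot>\<^bsub>N\<^esub> y))\<rparr>"

definition fc_sum :: "('r, 'x) fcomplex \<Rightarrow> ('r, 'y) fcomplex \<Rightarrow> ('r, 'x \<times> 'y) fcomplex" where
  "fc_sum A B = \<lparr>cobj = (\<lambda>n. module_sum (cobj A n) (cobj B n)),
     cdiff = (\<lambda>n (x, y). (cdiff A n x, cdiff B n y)),
     cfilt = (\<lambda>p n. cfilt A p n \<times> cfilt B p n)\<rparr>"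

text \<open>\<open>B_complex R k\<close> and \<open>phi R k\<close> are meaningful for \<open>k \<ge> 1\<close> only.\<close>

definition B_complex ::
    "('r, 'e) ring_scheme \<Rightarrow> nat \<Rightarrow> int \<Rightarrow> int \<Rightarrow> ('r, 'r \<times> 'r) fcomplex" where
  "B_complex R k p n =
     fc_sum (Z_complex R (k - 1) (p + int k - 1) (n - 1)) (Z_complex R (k - 1) (p - 1) n)"

text \<open>In degree \<open>n + 1\<close> the target is concentrated in its second summand, so the identity there
  reads \<open>x \<mapsto> (0, x)\<close>.\<close>

definition phi ::
    "('r, 'e) ring_scheme \<Rightarrow> nat \<Rightarrow> int \<Rightarrow> int \<Rightarrow> ('r, 'r, 'r \<times> 'r) fmor" where
  "phi R k p n = (Z_complex R k p n, B_complex R k p n,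
     (\<lambda>m x. if m = n then (x, x) else if m = n + 1 then (\<zero>\<^bsub>R\<^esub>, x) else (\<zero>\<^bsub>R\<^esub>, \<zero>\<^bsub>R\<^esub>)))"

definition gen_I :: "('r, 'e) ring_scheme \<Rightarrow> nat \<Rightarrow> ('r, 'r, 'r \<times> 'r) fmor set" where
  "gen_I R r = {phi R (r + 1) p n | p n. True}"

definition gen_J :: "('r, 'e) ring_scheme \<Rightarrow> nat \<Rightarrow> ('r, 'r, 'r) fmor set" where
  "gen_J R k = {from_zero R (Z_complex R k p n) | p n. True}"


section \<open>The model structure\<close>

text \<open>The morphisms in \<open>gen_I\<close> and \<open>gen_J\<close> have different HOL types, so the right lifting property
  with respect to their union is stated as a conjunction.\<close>

definition I_S_injective ::
    "('r, 'e) ring_scheme \<Rightarrow> nat \<Rightarrow> nat set \<Rightarrow> ('r, 'x, 'y) fmor \<Rightarrow> bool" where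
  "I_S_injective R r S q \<longleftrightarrow>
     injective_for R (gen_I R r) q \<and> injective_for R (\<Union>s\<in>S. gen_J R s) q"

definition fibration ::
    "('r, 'e) ring_scheme \<Rightarrow> nat set \<Rightarrow> ('r, 'x, 'y) fmor \<Rightarrow> bool" where
  "fibration R S q \<longleftrightarrow> injective_for R (\<Union>s\<in>S. gen_J R s) q"

definition acyclic_fibration ::
    "('r, 'e) ring_scheme \<Rightarrow> nat \<Rightarrow> nat set \<Rightarrow> ('r, 'x, 'y) fmor \<Rightarrow> bool" where
  "acyclic_fibration R r S q \<longleftrightarrow> fibration R S q \<and> quasi_iso R r q"

text \<open>The cofibrations generated by \<open>I_S\<close>, that is, the morphisms with the left lifting property with
  respect to all \<open>I_S\<close>-injective morphisms. A HOL formula cannot quantify over the types in which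
  the test complexes live, so these types \<open>'x\<close> and \<open>'y\<close> are parameters; a theorem in which they
  are type variables speaks about test complexes of arbitrary size.\<close>

definition cofibration ::
    "'x itself \<Rightarrow> 'y itself \<Rightarrow> ('r, 'e) ring_scheme \<Rightarrow> nat \<Rightarrow> nat set \<Rightarrow> ('r, 'a, 'b) fmor \<Rightarrow> bool"
  where
  "cofibration _ _ R r S f \<longleftrightarrow> fc_morphism R f \<and>
     (\<forall>q :: ('r, 'x, 'y) fmor. I_S_injective R r S q \<longrightarrow> lifts_against R f q)"

definition cofibrant ::
    "'x itself \<Rightarrow> 'y itself \<Rightarrow> ('r, 'e) ring_scheme \<Rightarrow> nat \<Rightarrow> nat set \<Rightarrow> ('r, 'a) fcomplex \<Rightarrow> bool"
  where
  "cofibrant tx ty R r S A \<longleftrightarrow> cofibration tx ty R r S (from_zero R A)"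


section \<open>The complex \<open>Q\<^sub>r\<bbbS>\<close>\<close>

text \<open>The direct sum of copies of \<open>R\<close> indexed by \<open>I\<close>, as finitely supported functions.\<close>

definition free_module :: "('r, 'e) ring_scheme \<Rightarrow> nat set \<Rightarrow> ('r, nat \<Rightarrow> 'r) module" where
  "free_module R I =
     \<lparr>carrier = {f. range f \<subseteq> carrier R \<and> finite {i. f i \<noteq> \<zero>\<^bsub>R\<^esub>} \<and> (\<forall>i. i \<notin> I \<longrightarrow> f i = \<zero>\<^bsub>R\<^esub>)},
      mult = undefined, one = undefined,
      zero = (\<lambda>_. \<zero>\<^bsub>R\<^esub>),
      add = (\<lambda>f g i. f i \<oplus>\<^bsub>R\<^esub> g i),
      smult = (\<lambda>a f i. a \<otimes>\<^bsub>R\<^esub> f i)\<rparr>"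

definition basis :: "('r, 'e) ring_scheme \<Rightarrow> nat \<Rightarrow> nat \<Rightarrow> 'r" where
  "basis R i = (\<lambda>j. if j = i then \<one>\<^bsub>R\<^esub> else \<zero>\<^bsub>R\<^esub>)"

definition Q_index :: "int \<Rightarrow> nat set" where
  "Q_index n = (if n = 0 then UNIV else if n = 1 then {1..} else {})"

text \<open>The filtration weight of the \<open>i\<close>-th generator in degree \<open>n\<close>, for \<open>n\<close> zero or one.\<close>

definition Q_weight :: "nat \<Rightarrow> int \<Rightarrow> nat \<Rightarrow> int" where
  "Q_weight r n i = (if n = 0 then - int i else - int r - int i)"

text \<open>In degree one the \<open>j\<close>-th generator occurs in the differentials of the generators \<open>j - 1\<close>
  and \<open>j\<close> of degree zero; see the two lemmas below.\<close>

definition Q_complex :: "('r, 'e) ring_scheme \<Rightarrow> nat \<Rightarrow> ('r, nat \<Rightarrow> 'r) fcomplex" where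
  "Q_complex R r =
     \<lparr>cobj = (\<lambda>n. free_module R (Q_index n)),
      cdiff = (\<lambda>n f. if n = 0 then (\<lambda>j. if j = 0 then \<zero>\<^bsub>R\<^esub> else f (j - 1) \<oplus>\<^bsub>R\<^esub> f j)
                      else (\<lambda>_. \<zero>\<^bsub>R\<^esub>)),
      cfilt = (\<lambda>p n. {f \<in> carrier (free_module R (Q_index n)).
                        \<forall>i. f i \<noteq> \<zero>\<^bsub>R\<^esub> \<longrightarrow> Q_weight r n i \<le> p})\<rparr>"

lemma Q_complex_diff_basis_0:
  assumes "cring R"
  shows "cdiff (Q_complex R r) 0 (basis R 0) = basis R 1"
proof -
  interpret cring R by fact
  show ?thesis by (auto simp: Q_complex_def basis_def)
qed

lemma Q_complex_diff_basis:
  assumes "cring R" "i \<ge> 1"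
  shows "cdiff (Q_complex R r) 0 (basis R i) = basis R i \<oplus>\<^bsub>cobj (Q_complex R r) 1\<^esub> basis R (i + 1)"
proof -
  interpret cring R by fact
  show ?thesis
    using assms(2) by (intro ext) (auto simp: Q_complex_def basis_def free_module_def)
qed

end

theory Submission
  imports Defs
begin

text \<open>A map out of \<open>Q\<^sub>r\<bbbS>\<close> is a pair of sequences \<open>x\<^sub>i \<in> F\<^sub>-\<^sub>i X\<^sup>0\<close> and
  \<open>y\<^sub>i \<in> F\<^sub>-\<^sub>r\<^sub>-\<^sub>i X\<^sup>1\<close> of cycles with \<open>y\<^sub>0 = 0\<close> and \<open>d x\<^sub>i = y\<^sub>i + y\<^sub>i\<^sub>+\<^sub>1\<close>. Such a pair is lifted along
  \<open>q : X \<rightarrow> Y\<close> one index at a time: having lifted \<open>y\<^sub>i\<close>, lift \<open>x\<^sub>i\<close> to some \<open>z \<in> Z\<^sub>r(X)\<close>, which is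
  possible by the lifting property against \<open>J\<^sub>r\<close>. The cycle \<open>c = d z - y\<^sub>i\<close> lies over \<open>y\<^sub>i\<^sub>+\<^sub>1\<close> but
  perhaps one filtration step too high. Subtracting from \<open>z\<close> an element \<open>w\<close> of the kernel of \<open>q\<close>
  such that \<open>c - d w\<close> lies one step lower repairs this. The element \<open>w\<close> comes from the lifting
  property against \<open>\<phi>\<^sub>r\<^sub>+\<^sub>1\<close>, or, for an acyclic fibration, from the bijectivity on the \<open>r + 1\<close>-page.\<close>

section \<open>Linear maps and filtered complexes\<close>

lemma linear_mapsI:
  assumes "\<And>x. x \<in> carrier M \<Longrightarrow> f x \<in> carrier N"
    and "\<And>x y. x \<in> carrier M \<Longrightarrow> y \<in> carrier M \<Longrightarrow> f (x \<oplus>\<^bsub>M\<^esub> y) = f x \<oplus>\<^bsub>N\<^esub> f y"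
    and "\<And>a x. a \<in> carrier R \<Longrightarrow> x \<in> carrier M \<Longrightarrow> f (a \<odot>\<^bsub>M\<^esub> x) = a \<odot>\<^bsub>N\<^esub> f x"
  shows "f \<in> linear_maps R M N"
  using assms by (auto simp: linear_maps_def hom_def)

lemma fc_hom_diff:
  "h \<in> fc_hom R A B \<Longrightarrow> x \<in> carrier (cobj A n) \<Longrightarrow> h (n + 1) (cdiff A n x) = cdiff B n (h n x)"
  by (simp add: fc_hom_def)

lemma fc_hom_filt: "h \<in> fc_hom R A B \<Longrightarrow> x \<in> cfilt A p n \<Longrightarrow> h n x \<in> cfilt B p n"
  by (auto simp: fc_hom_def image_subset_iff)

lemma lifts_againstE:
  assumes "lifts_against R (A, B, i) (X, Y, q)" "u \<in> fc_hom R A X" "v \<in> fc_hom R B Y"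
    and "\<And>n a. a \<in> carrier (cobj A n) \<Longrightarrow> q n (u n a) = v n (i n a)"
  obtains h where "h \<in> fc_hom R B X"
    "\<And>n a. a \<in> carrier (cobj A n) \<Longrightarrow> h n (i n a) = u n a"
    "\<And>n b. b \<in> carrier (cobj B n) \<Longrightarrow> q n (h n b) = v n b"
  using assms unfolding lifts_against_def by fast

locale linear_map = M: module R M + N: module R N for R (structure) and M and N +
  fixes f
  assumes linear: "f \<in> linear_maps R M N"
begin

lemma closed [simp, intro]: "x \<in> carrier M \<Longrightarrow> f x \<in> carrier N"
  using linear by (auto simp: linear_maps_def hom_def)

lemma add [simp]: "x \<in> carrier M \<Longrightarrow> y \<in> carrier M \<Longrightarrow> f (x \<oplus>\<^bsub>M\<^esub> y) = f x \<oplus>\<^bsub>N\<^esub> f y"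
  using linear by (auto simp: linear_maps_def hom_def)

lemma smult [simp]: "a \<in> carrier R \<Longrightarrow> x \<in> carrier M \<Longrightarrow> f (a \<odot>\<^bsub>M\<^esub> x) = a \<odot>\<^bsub>N\<^esub> f x"
  using linear by (auto simp: linear_maps_def)

lemma zero [simp]: "f \<zero>\<^bsub>M\<^esub> = \<zero>\<^bsub>N\<^esub>"
  using smult[of \<zero> "\<zero>\<^bsub>M\<^esub>"] by simp

lemma uminus [simp]: "x \<in> carrier M \<Longrightarrow> f (\<ominus>\<^bsub>M\<^esub> x) = \<ominus>\<^bsub>N\<^esub> f x"
  using add[of x "\<ominus>\<^bsub>M\<^esub> x"] by (metis M.a_inv_closed M.l_neg N.minus_equality add closed zero)

lemma minus [simp]: "x \<in> carrier M \<Longrightarrow> y \<in> carrier M \<Longrightarrow> f (x \<ominus>\<^bsub>M\<^esub> y) = f x \<ominus>\<^bsub>N\<^esub> f y"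
  by (simp add: a_minus_def)

lemma finsum: "g \<in> T \<rightarrow> carrier M \<Longrightarrow> f (finsum M g T) = finsum N (\<lambda>i. f (g i)) T"
proof (induction T rule: infinite_finite_induct)
  case (insert a T)
  then have "g \<in> T \<rightarrow> carrier M" "g a \<in> carrier M" by auto
  with insert show ?case by (simp add: Pi_def)
qed auto

end

text \<open>Negation is scaling by \<open>\<ominus> \<one>\<close>, so closure under negation
  follows from closure under scaling.\<close>

lemma (in module) submoduleI_smult:
  assumes "H \<subseteq> carrier M" "\<zero>\<^bsub>M\<^esub> \<in> H"
    and "\<And>a b. a \<in> H \<Longrightarrow> b \<in> H \<Longrightarrow> a \<oplus>\<^bsub>M\<^esub> b \<in> H"
    and smult: "\<And>a x. a \<in> carrier R \<Longrightarrow> x \<in> H \<Longrightarrow> a \<odot>\<^bsub>M\<^esub> x \<in> H"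
  shows "submodule H R M"
proof (rule submoduleI)
  fix a assume "a \<in> H"
  with assms(1) smult[of "\<ominus> \<one>" a] show "\<ominus>\<^bsub>M\<^esub> a \<in> H"
    by (auto simp: smult_l_minus subset_iff)
qed (use assms in auto)

section \<open>Filtered complexes and filtered maps\<close>

locale filtered_cx = cring R for R (structure) +
  fixes A :: "('a, 'x) fcomplex"
  assumes filtered_complex: "filtered_complex R A"
begin

sublocale M: module R "cobj A n" for n
  using filtered_complex by (simp add: filtered_complex_def)

sublocale D: linear_map R "cobj A n" "cobj A (n + 1)" "cdiff A n" for n
  by unfold_locales (use filtered_complex in \<open>simp add: filtered_complex_def\<close>)

lemma diff_diff: "x \<in> carrier (cobj A n) \<Longrightarrow> cdiff A (n + 1) (cdiff A n x) = \<zero>\<^bsub>cobj A (n + 2)\<^esub>"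
  using filtered_complex by (simp add: filtered_complex_def)

lemma filt_submodule: "submodule (cfilt A p n) R (cobj A n)"
  using filtered_complex by (simp add: filtered_complex_def)

lemma filt_in [dest]: "x \<in> cfilt A p n \<Longrightarrow> x \<in> carrier (cobj A n)"
  using M.submoduleE(1)[OF filt_submodule] by auto

lemma filt_add [intro]:
  "x \<in> cfilt A p n \<Longrightarrow> y \<in> cfilt A p n \<Longrightarrow> x \<oplus>\<^bsub>cobj A n\<^esub> y \<in> cfilt A p n"
  using M.submoduleE(5)[OF filt_submodule] by auto

lemma filt_smult [intro]: "a \<in> carrier R \<Longrightarrow> x \<in> cfilt A p n \<Longrightarrow> a \<odot>\<^bsub>cobj A n\<^esub> x \<in> cfilt A p n"
  using M.submoduleE(4)[OF filt_submodule] by auto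

lemma filt_zero [simp, intro]: "\<zero>\<^bsub>cobj A n\<^esub> \<in> cfilt A p n"
proof -
  obtain x where x: "x \<in> cfilt A p n" using M.submoduleE(2)[OF filt_submodule] by auto
  with filt_smult[of \<zero> x p n] filt_in[OF x] show ?thesis by simp
qed

lemma filt_uminus [intro]: "x \<in> cfilt A p n \<Longrightarrow> \<ominus>\<^bsub>cobj A n\<^esub> x \<in> cfilt A p n"
  using M.submoduleE(3)[OF filt_submodule] by auto

lemma filt_minus [intro]:
  "x \<in> cfilt A p n \<Longrightarrow> y \<in> cfilt A p n \<Longrightarrow> x \<ominus>\<^bsub>cobj A n\<^esub> y \<in> cfilt A p n"
  by (simp add: a_minus_def filt_add filt_uminus)

lemma filt_finsum:
  "g \<in> T \<rightarrow> cfilt A p n \<Longrightarrow> finsum (cobj A n) g T \<in> cfilt A p n"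
proof (induction T rule: infinite_finite_induct)
  case (insert a T)
  then have "g \<in> T \<rightarrow> cfilt A p n" "g a \<in> cfilt A p n" by auto
  moreover from this have "g \<in> T \<rightarrow> carrier (cobj A n)" "g a \<in> carrier (cobj A n)" by auto
  ultimately show ?case using insert by (simp add: Pi_def filt_add)
qed auto

lemma filt_diff [intro]: "x \<in> cfilt A p n \<Longrightarrow> cdiff A n x \<in> cfilt A p (n + 1)"
  using filtered_complex by (auto simp: filtered_complex_def image_subset_iff)

lemma filt_mono:
  assumes "x \<in> cfilt A p n" "p \<le> q" shows "x \<in> cfilt A q n"
  using assms(2,1)
proof (induction q rule: int_ge_induct)
  case (step i)
  then show ?case using filtered_complex by (simp add: filtered_complex_def subset_iff)
qed

end

locale filtered_map = cring R + X: filtered_cx R X + Y: filtered_cx R Y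
  for R (structure) and X :: "('a, 'x) fcomplex" and Y :: "('a, 'y) fcomplex" +
  fixes f
  assumes fc_hom: "f \<in> fc_hom R X Y"
begin

sublocale F: linear_map R "cobj X n" "cobj Y n" "f n" for n
  by unfold_locales (use fc_hom in \<open>simp add: fc_hom_def\<close>)

lemma map_diff: "x \<in> carrier (cobj X n) \<Longrightarrow> f (n + 1) (cdiff X n x) = cdiff Y n (f n x)"
  using fc_hom by (simp add: fc_hom_def)

lemma map_filt: "x \<in> cfilt X p n \<Longrightarrow> f n x \<in> cfilt Y p n"
  using fc_hom by (auto simp: fc_hom_def image_subset_iff)

end

lemma fc_morphism_imp_filtered_map:
  assumes "cring R" "fc_morphism R (X, Y, f)" shows "filtered_map R X Y f"
  using assms unfolding fc_morphism_def
  by (auto intro!: filtered_map.intro filtered_cx.intro filtered_cx_axioms.intro filtered_map_axioms.intro)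

section \<open>Lifting and correcting cycles\<close>

text \<open>The morphism out of \<open>Z\<^sub>k(p, n)\<close> classified by a cycle \<open>y\<close>.\<close>

definition Z_map :: "('r, 'x) fcomplex \<Rightarrow> int \<Rightarrow> 'x \<Rightarrow> int \<Rightarrow> 'r \<Rightarrow> 'x" where
  "Z_map A n y m a = (if m = n then a \<odot>\<^bsub>cobj A n\<^esub> y
     else if m = n + 1 then a \<odot>\<^bsub>cobj A (n + 1)\<^esub> cdiff A n y else \<zero>\<^bsub>cobj A m\<^esub>)"

section \<open>Cycles, boundaries and maps out of \<open>Z_complex\<close>\<close>

context filtered_cx
begin

lemma cycles_in: "x \<in> cycles A k p n \<Longrightarrow> x \<in> carrier (cobj A n)"
  by (auto simp: cycles_def)

text \<open>The complex \<open>Z_complex R k p n\<close> is free on a generator of filtration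
  \<open>p\<close> in degree \<open>n\<close> together with its differential, placed in filtration
  \<open>p - int k\<close>. Membership in \<open>cycles\<close> is exactly what makes sending the
  generator to \<open>y\<close> respect both filtrations.\<close>

lemma Z_map_fc_hom:
  assumes y: "y \<in> cycles A k p n"
  shows "Z_map A n y \<in> fc_hom R (Z_complex R k p n) A"
proof -
  have [simp]: "y \<in> carrier (cobj A n)" using y by (rule cycles_in)
  have yf: "y \<in> cfilt A p n" "cdiff A n y \<in> cfilt A (p - int k) (n + 1)"
    using y by (auto simp: cycles_def)
  \<comment> \<open>Needed for the chain map equation in degree \<open>n + 1\<close>, where the
    differential of the source vanishes.\<close>
  have dd: "cdiff A (n + 1) (cdiff A n y) = \<zero>\<^bsub>cobj A (n + 1 + 1)\<^esub>"
    by (simp add: diff_diff[of y n, simplified] add.assoc)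
  have "Z_map A n y m \<in> linear_maps R (cobj (Z_complex R k p n) m) (cobj A m)" for m
    by (rule linear_mapsI)
      (auto simp: Z_map_def Z_complex_def rank_one_def M.smult_l_distr M.smult_assoc1 split: if_splits)
  moreover have "Z_map A n y (m + 1) (cdiff (Z_complex R k p n) m a) = cdiff A m (Z_map A n y m a)"
    if "a \<in> carrier (cobj (Z_complex R k p n) m)" for m a
    using that dd by (auto simp: Z_map_def Z_complex_def rank_one_def split: if_splits)
  moreover have "Z_map A n y m a \<in> cfilt A q m" if "a \<in> cfilt (Z_complex R k p n) q m" for q m a
    using that yf
    by (auto simp: Z_map_def Z_complex_def split: if_splits intro: filt_mono filt_smult)
  ultimately show ?thesis by (auto simp: fc_hom_def)
qed

lemma zero_fc_hom: "(\<lambda>m _. \<zero>\<^bsub>cobj A m\<^esub>) \<in> fc_hom R B A"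
  by (auto simp: fc_hom_def intro!: linear_mapsI)

lemma cycles_add:
  "x \<in> cycles A k p n \<Longrightarrow> y \<in> cycles A k p n \<Longrightarrow> x \<oplus>\<^bsub>cobj A n\<^esub> y \<in> cycles A k p n"
  by (auto simp: cycles_def filt_in)

lemma cycles_uminus: "x \<in> cycles A k p n \<Longrightarrow> \<ominus>\<^bsub>cobj A n\<^esub> x \<in> cycles A k p n"
  by (auto simp: cycles_def filt_in)

lemma cycles_zero: "\<zero>\<^bsub>cobj A n\<^esub> \<in> cycles A k p n"
  by (auto simp: cycles_def)

text \<open>\<open>boundaries\<close> uses the differential from degree \<open>n - 1\<close> into
  degree \<open>n\<close>, whereas the instance from the locale ends in \<open>n - 1 + 1\<close>,
  which is not syntactically \<open>n\<close>.\<close>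

lemma diff_linear_map: "linear_map R (cobj A (n - 1)) (cobj A n) (cdiff A (n - 1))"
  using D.linear_map_axioms[of "n - 1"] by simp

lemma in_boundaries_Suc_iff:
  "x \<in> boundaries A (Suc k) p n \<longleftrightarrow>
     (\<exists>w\<in>cycles A k (p + int k) (n - 1). \<exists>u\<in>cycles A k (p - 1) n.
        x = cdiff A (n - 1) w \<oplus>\<^bsub>cobj A n\<^esub> u)"
  by (auto simp: set_add_def')

text \<open>A page is a set of cosets, and the coset lemmas ask for an additive subgroup. Negation
  and addition act separately on the two components \<open>w\<close> and \<open>u\<close>.\<close>

lemma boundaries_subgroup: "subgroup (boundaries A (Suc k) p n) (add_monoid (cobj A n))"
proof -
  interpret D': linear_map R "cobj A (n - 1)" "cobj A n" "cdiff A (n - 1)" by (rule diff_linear_map)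
  note [simp] = cycles_in
  show ?thesis
  proof (rule M.add.subgroupI)
    show "boundaries A (Suc k) p n \<subseteq> carrier (cobj A n)"
      unfolding subset_iff in_boundaries_Suc_iff by auto
    have "\<zero>\<^bsub>cobj A n\<^esub> \<in> boundaries A (Suc k) p n"
      unfolding in_boundaries_Suc_iff
      by (rule bexI[OF _ cycles_zero], rule bexI[OF _ cycles_zero]) simp
    then show "boundaries A (Suc k) p n \<noteq> {}" by blast
  next
    fix a assume "a \<in> boundaries A (Suc k) p n"
    then obtain w u where wu: "w \<in> cycles A k (p + int k) (n - 1)" "u \<in> cycles A k (p - 1) n"
      "a = cdiff A (n - 1) w \<oplus>\<^bsub>cobj A n\<^esub> u" unfolding in_boundaries_Suc_iff by blast
    then have "\<ominus>\<^bsub>cobj A n\<^esub> a = cdiff A (n - 1) (\<ominus>\<^bsub>cobj A (n - 1)\<^esub> w) \<oplus>\<^bsub>cobj A n\<^esub> \<ominus>\<^bsub>cobj A n\<^esub> u"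
      by (simp add: M.minus_add)
    with wu show "\<ominus>\<^bsub>cobj A n\<^esub> a \<in> boundaries A (Suc k) p n"
      unfolding in_boundaries_Suc_iff using cycles_uminus by blast
    fix b assume "b \<in> boundaries A (Suc k) p n"
    then obtain w' u' where wu': "w' \<in> cycles A k (p + int k) (n - 1)" "u' \<in> cycles A k (p - 1) n"
      "b = cdiff A (n - 1) w' \<oplus>\<^bsub>cobj A n\<^esub> u'" unfolding in_boundaries_Suc_iff by blast
    with wu have "a \<oplus>\<^bsub>cobj A n\<^esub> b =
      cdiff A (n - 1) (w \<oplus>\<^bsub>cobj A (n - 1)\<^esub> w') \<oplus>\<^bsub>cobj A n\<^esub> (u \<oplus>\<^bsub>cobj A n\<^esub> u')"
      by (simp add: M.a_ac)
    with wu wu' show "a \<oplus>\<^bsub>cobj A n\<^esub> b \<in> boundaries A (Suc k) p n"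
      unfolding in_boundaries_Suc_iff using cycles_add by blast
  qed
qed

lemma cycles_subset_boundaries: "cycles A k (p - 1) n \<subseteq> boundaries A (Suc k) p n"
proof
  interpret D': linear_map R "cobj A (n - 1)" "cobj A n" "cdiff A (n - 1)" by (rule diff_linear_map)
  fix u assume "u \<in> cycles A k (p - 1) n"
  then show "u \<in> boundaries A (Suc k) p n"
    unfolding in_boundaries_Suc_iff
    by (intro bexI[OF _ cycles_zero] bexI[of _ u]) (auto simp: cycles_in)
qed

end

text \<open>This is \<open>g\<close> composed with the projection onto the second summand. It
  produces maps out of \<open>B_complex\<close> that vanish on the first summand.\<close>

lemma snd_fc_hom:
  assumes "g \<in> fc_hom R B Y"
  shows "(\<lambda>m (a, b). g m b) \<in> fc_hom R (fc_sum A B) Y"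
  using assms
  by (auto simp: fc_hom_def fc_sum_def module_sum_def linear_maps_def hom_def image_subset_iff)

section \<open>Lifting properties in terms of elements\<close>

context filtered_map
begin

text \<open>By the universal property of \<open>Z_complex\<close>, this is the right lifting
  property against \<open>gen_J R k\<close> read on elements.\<close>

definition lifts_cycles :: "nat \<Rightarrow> bool" where
  "lifts_cycles k \<longleftrightarrow> (\<forall>p n. \<forall>y\<in>cycles Y k p n. \<exists>x\<in>cycles X k p n. f n x = y)"

text \<open>The part of the right lifting property against \<open>gen_I R r\<close> that concerns
  pairs \<open>(0, f c)\<close>. The indices \<open>p\<close> and \<open>n\<close> belong to the
  correcting element \<open>w\<close>, so \<open>c\<close> sits in degree \<open>n + 1\<close> and
  filtration \<open>p - int r\<close>.\<close>

definition corrects_cycles :: "nat \<Rightarrow> bool" where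
  "corrects_cycles r \<longleftrightarrow>
     (\<forall>p n. \<forall>c\<in>cfilt X (p - int r) (n + 1).
        cdiff X (n + 1) c = \<zero>\<^bsub>cobj X (n + 2)\<^esub> \<longrightarrow>
        f (n + 1) c \<in> cfilt Y (p - int r - 1) (n + 1) \<longrightarrow>
        (\<exists>w\<in>cfilt X p n. f n w = \<zero>\<^bsub>cobj Y n\<^esub> \<and>
           c \<ominus>\<^bsub>cobj X (n + 1)\<^esub> cdiff X n w \<in> cfilt X (p - int r - 1) (n + 1)))"

text \<open>A lift of the map classified by \<open>y\<close> sends the generator to the desired
  preimage. Being a filtered chain map, it forces both filtration conditions.\<close>

lemma lifts_cycles_if_lifts:
  assumes "\<And>p n. lifts_against R (from_zero R (Z_complex R k p n)) (X, Y, f)"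
  shows "lifts_cycles k"
  unfolding lifts_cycles_def
proof (intro allI ballI)
  fix p n y assume y: "y \<in> cycles Y k p n"
  have v: "Z_map Y n y \<in> fc_hom R (Z_complex R k p n) Y" by (rule Y.Z_map_fc_hom[OF y])
  \<comment> \<open>The square commutes because both paths from the zero complex give zero.\<close>
  have Z0: "Z_map Y n y m \<zero> = \<zero>\<^bsub>cobj Y m\<^esub>" for m
    using y[THEN Y.cycles_in] by (auto simp: Z_map_def)
  obtain h where h: "h \<in> fc_hom R (Z_complex R k p n) X"
    and fh: "\<And>m b. b \<in> carrier (cobj (Z_complex R k p n) m) \<Longrightarrow> f m (h m b) = Z_map Y n y m b"
  proof (rule lifts_againstE[OF assms[of p n, unfolded from_zero_def] X.zero_fc_hom v])
    show "f m \<zero>\<^bsub>cobj X m\<^esub> = Z_map Y n y m \<zero>\<^bsub>cobj (Z_complex R k p n) m\<^esub>" for m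
      by (simp add: Z_complex_def rank_one_def Z0)
  qed blast
  have one: "\<one> \<in> carrier (cobj (Z_complex R k p n) n)" by (simp add: Z_complex_def rank_one_def)
  have "f n (h n \<one>) = y" using fh[OF one] y[THEN Y.cycles_in] by (simp add: Z_map_def)
  moreover have "h n \<one> \<in> cfilt X p n"
    by (rule fc_hom_filt[OF h]) (simp add: Z_complex_def)
  moreover have "cdiff X n (h n \<one>) = h (n + 1) \<one>"
    using fc_hom_diff[OF h one] by (simp add: Z_complex_def)
  moreover have "h (n + 1) \<one> \<in> cfilt X (p - int k) (n + 1)"
    by (rule fc_hom_filt[OF h]) (simp add: Z_complex_def)
  ultimately show "\<exists>x\<in>cycles X k p n. f n x = y" by (auto simp: cycles_def)
qed

text \<open>The square has the map classified by \<open>c\<close> on top and the one classified by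
  \<open>(0, f c)\<close> below. A lift \<open>h\<close> splits \<open>c\<close> into the images of
  \<open>(\<one>, \<zero>)\<close> and \<open>(\<zero>, \<one>)\<close>: the first is the
  differential of an element over zero, the second lies one filtration step lower.\<close>

lemma corrects_cycles_if_lifts:
  assumes "\<And>p n. lifts_against R (phi R (Suc r) p n) (X, Y, f)"
  shows "corrects_cycles r"
  unfolding corrects_cycles_def
proof (intro allI ballI impI)
  fix p n c assume c: "c \<in> cfilt X (p - int r) (n + 1)"
    and dc: "cdiff X (n + 1) c = \<zero>\<^bsub>cobj X (n + 2)\<^esub>"
    and fc: "f (n + 1) c \<in> cfilt Y (p - int r - 1) (n + 1)"
  have c_in [simp]: "c \<in> carrier (cobj X (n + 1))" using c by (rule X.filt_in)
  have dfc: "cdiff Y (n + 1) (f (n + 1) c) = \<zero>\<^bsub>cobj Y (n + 2)\<^esub>"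
    using map_diff[of c "n + 1"] dc by (simp add: add.assoc)
  let ?Z = "Z_complex R (Suc r) (p - int r) (n + 1)"
  let ?B = "B_complex R (Suc r) (p - int r) (n + 1)"
  \<comment> \<open>\<open>v\<close> is the map out of \<open>B\<^sub>r\<^sub>+\<^sub>1\<close> classified by the pair \<open>(0, f c)\<close>.\<close>
  define v where "v = (\<lambda>m (a :: 'a, b). Z_map Y (n + 1) (f (n + 1) c) m b)"
  have "c \<in> cycles X (Suc r) (p - int r) (n + 1)"
    using c dc by (simp add: cycles_def add.assoc)
  then have u: "Z_map X (n + 1) c \<in> fc_hom R ?Z X" by (rule X.Z_map_fc_hom)
  have "f (n + 1) c \<in> cycles Y r (p - int r - 1) (n + 1)"
    using fc dfc by (simp add: cycles_def add.assoc)
  then have v: "v \<in> fc_hom R ?B Y"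
    unfolding v_def B_complex_def by (simp add: snd_fc_hom Y.Z_map_fc_hom)
  \<comment> \<open>\<open>phi\<close> writes the upper degree as \<open>n + 1 + 1\<close>, while
    \<open>comm\<close> and \<open>hu\<close> use \<open>n + 2\<close>.\<close>
  have two: "n + 2 = n + 1 + 1" by simp
  have comm: "f m (Z_map X (n + 1) c m a) = v m (if m = n + 1 then (a, a)
      else if m = n + 2 then (\<zero>, a) else (\<zero>, \<zero>))" if "a \<in> carrier (cobj ?Z m)" for m a
    using that dc dfc c_in by (auto simp: v_def Z_map_def Z_complex_def rank_one_def add.assoc split: if_splits)
  obtain h where h: "h \<in> fc_hom R ?B X"
    and hu: "\<And>m a. a \<in> carrier (cobj ?Z m) \<Longrightarrow> h m (if m = n + 1 then (a, a)
      else if m = n + 2 then (\<zero>, a) else (\<zero>, \<zero>)) = Z_map X (n + 1) c m a"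
    and fh: "\<And>m b. b \<in> carrier (cobj ?B m) \<Longrightarrow> f m (h m b) = v m b"
    using lifts_againstE[OF assms[of "p - int r" "n + 1", unfolded phi_def] u v]
      comm[unfolded two] unfolding two by blast
  \<comment> \<open>At the chosen indices, \<open>?B\<close> is the sum of the
    \<open>Z_complex\<close> at \<open>(p, n)\<close> and the one at
    \<open>(p - r - 1, n + 1)\<close>, both for \<open>k = r\<close>. The first generator gives
    \<open>w\<close>, the second the corrected cycle.\<close>
  have B: "cobj ?B m = module_sum (rank_one R (m = n \<or> m = n + 1)) (rank_one R (m = n + 1 \<or> m = n + 2))"
    "cfilt ?B q m = (if m = n \<and> p \<le> q \<or> m = n + 1 \<and> p - int r \<le> q then carrier R else {\<zero>})
       \<times> (if m = n + 1 \<and> p - int r - 1 \<le> q \<or> m = n + 2 \<and> p - int r - 1 - int r \<le> q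
          then carrier R else {\<zero>})"
    "cdiff ?B n (a, b) = (a, \<zero>)" for m q a b
    by (simp_all add: B_complex_def fc_sum_def Z_complex_def add.assoc)
  have w: "h n (\<one>, \<zero>) \<in> cfilt X p n"
    by (rule fc_hom_filt[OF h]) (simp add: B)
  have u': "h (n + 1) (\<zero>, \<one>) \<in> cfilt X (p - int r - 1) (n + 1)"
    by (rule fc_hom_filt[OF h]) (simp add: B)
  have dw: "cdiff X n (h n (\<one>, \<zero>)) = h (n + 1) (\<one>, \<zero>)"
  proof -
    have "(\<one>, \<zero>) \<in> carrier (cobj ?B n)" by (simp add: B module_sum_def rank_one_def)
    from fc_hom_diff[OF h this] show ?thesis by (simp add: B)
  qed
  have "f n (h n (\<one>, \<zero>)) = \<zero>\<^bsub>cobj Y n\<^esub>"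
    using fh[of "(\<one>, \<zero>)" n] by (simp add: B module_sum_def rank_one_def v_def Z_map_def)
  moreover have "c \<ominus>\<^bsub>cobj X (n + 1)\<^esub> cdiff X n (h n (\<one>, \<zero>)) = h (n + 1) (\<zero>, \<one>)"
  proof -
    \<comment> \<open>The map \<open>phi\<close> takes the generator of its source to the diagonal
      element, and the top map takes it to \<open>c\<close>.\<close>
    have "c = h (n + 1) (\<one>, \<one>)"
      using hu[of "\<one>" "n + 1"] by (simp add: Z_complex_def rank_one_def Z_map_def)
    also have "(\<one>, \<one>) = (\<zero>, \<one>) \<oplus>\<^bsub>cobj ?B (n + 1)\<^esub> (\<one>, \<zero>)"
      by (simp add: B module_sum_def rank_one_def)
    also have "h (n + 1) \<dots> = h (n + 1) (\<zero>, \<one>) \<oplus>\<^bsub>cobj X (n + 1)\<^esub> h (n + 1) (\<one>, \<zero>)"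
    proof -
      have "(\<zero>, \<one>) \<in> carrier (cobj ?B (n + 1))" "(\<one>, \<zero>) \<in> carrier (cobj ?B (n + 1))"
        by (simp_all add: B module_sum_def rank_one_def)
      with h show ?thesis by (simp add: fc_hom_def linear_maps_def hom_def)
    qed
    finally show ?thesis
      using u'[THEN X.filt_in] w[THEN X.filt_in] dw
      by (metis X.D.closed X.M.add.inv_solve_right X.M.a_closed a_minus_def)
  qed
  ultimately show "\<exists>w\<in>cfilt X p n. f n w = \<zero>\<^bsub>cobj Y n\<^esub> \<and>
      c \<ominus>\<^bsub>cobj X (n + 1)\<^esub> cdiff X n w \<in> cfilt X (p - int r - 1) (n + 1)"
    using w u' by auto
qed

section \<open>The induced maps on pages\<close>

lemma map_cycles: "x \<in> cycles X k p n \<Longrightarrow> f n x \<in> cycles Y k p n"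
  using map_diff[of x n, OF X.cycles_in] by (simp add: cycles_def map_filt) (metis map_filt)

lemma map_diff': "x \<in> carrier (cobj X (n - 1)) \<Longrightarrow> f n (cdiff X (n - 1) x) = cdiff Y (n - 1) (f (n - 1) x)"
  using map_diff[of x "n - 1"] by simp

lemma map_boundaries:
  assumes "x \<in> boundaries X (Suc k) p n" shows "f n x \<in> boundaries Y (Suc k) p n"
proof -
  interpret D': linear_map R "cobj X (n - 1)" "cobj X n" "cdiff X (n - 1)" by (rule X.diff_linear_map)
  from assms obtain w u where "w \<in> cycles X k (p + int k) (n - 1)" "u \<in> cycles X k (p - 1) n"
      "x = cdiff X (n - 1) w \<oplus>\<^bsub>cobj X n\<^esub> u" unfolding X.in_boundaries_Suc_iff by blast
  then show ?thesis
    unfolding Y.in_boundaries_Suc_iff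
    by (intro bexI[of _ "f (n - 1) w"] bexI[of _ "f n u"])
      (auto simp: map_cycles X.cycles_in map_diff')
qed

text \<open>\<open>page_map\<close> is a union over all representatives. Each gives the same coset
  because boundaries go to boundaries, and the union is not empty because \<open>x\<close> lies in
  its own coset.\<close>

lemma page_map_coset:
  assumes "x \<in> cycles X (Suc k) p n"
  shows "page_map (X, Y, f) (Suc k) p n (boundaries X (Suc k) p n +>\<^bsub>cobj X n\<^esub> x) =
    boundaries Y (Suc k) p n +>\<^bsub>cobj Y n\<^esub> f n x" (is "_ = ?BY +>\<^bsub>_\<^esub> _")
proof -
  let ?BX = "boundaries X (Suc k) p n"
  have x: "x \<in> carrier (cobj X n)" using assms by (rule X.cycles_in)
  have eq: "?BY +>\<^bsub>cobj Y n\<^esub> f n x' = ?BY +>\<^bsub>cobj Y n\<^esub> f n x" if "x' \<in> ?BX +>\<^bsub>cobj X n\<^esub> x" for x'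
  proof -
    from that obtain b where b: "b \<in> ?BX" "x' = b \<oplus>\<^bsub>cobj X n\<^esub> x"
      unfolding a_r_coset_def' by blast
    moreover have "b \<in> carrier (cobj X n)"
      using b(1) X.boundaries_subgroup[THEN subgroup.subset] by fastforce
    ultimately have "f n x' \<in> ?BY +>\<^bsub>cobj Y n\<^esub> f n x"
      using x map_boundaries[OF b(1)] unfolding a_r_coset_def' by auto
    then show ?thesis
      using Y.M.a_repr_independence[OF _ _ Y.boundaries_subgroup] x by blast
  qed
  have "x \<in> ?BX +>\<^bsub>cobj X n\<^esub> x"
    using x X.boundaries_subgroup[of k p n, THEN subgroup.one_closed]
    unfolding a_r_coset_def' by force
  with eq show ?thesis unfolding page_map_def prod.case by blast
qed

text \<open>The classes of \<open>c\<close> and of zero have the same image on the page of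
  \<open>Y\<close>, so injectivity identifies them on the page of \<open>X\<close>.\<close>

lemma boundaries_if_page_map_inj:
  assumes inj: "inj_on (page_map (X, Y, f) (Suc k) p n) (page X (Suc k) p n)"
    and c: "c \<in> cycles X (Suc k) p n" and fc: "f n c \<in> boundaries Y (Suc k) p n"
  shows "c \<in> boundaries X (Suc k) p n"
proof -
  let ?BX = "boundaries X (Suc k) p n" and ?BY = "boundaries Y (Suc k) p n"
  have zero: "\<zero>\<^bsub>cobj Y n\<^esub> \<in> ?BY" "\<zero>\<^bsub>cobj X n\<^esub> \<in> ?BX"
    using X.boundaries_subgroup[of k p n, THEN subgroup.one_closed]
      Y.boundaries_subgroup[of k p n, THEN subgroup.one_closed] by (simp_all only: monoid.simps)
  have "?BY +>\<^bsub>cobj Y n\<^esub> f n c = ?BY +>\<^bsub>cobj Y n\<^esub> f n \<zero>\<^bsub>cobj X n\<^esub>"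
    using fc zero X.cycles_in[OF c]
    by (simp add: Y.M.a_coset_join2 Y.boundaries_subgroup del: boundaries.simps)
  then have "page_map (X, Y, f) (Suc k) p n (?BX +>\<^bsub>cobj X n\<^esub> c) =
      page_map (X, Y, f) (Suc k) p n (?BX +>\<^bsub>cobj X n\<^esub> \<zero>\<^bsub>cobj X n\<^esub>)"
    by (simp only: page_map_coset c X.cycles_zero)
  with inj have "?BX +>\<^bsub>cobj X n\<^esub> c = ?BX +>\<^bsub>cobj X n\<^esub> \<zero>\<^bsub>cobj X n\<^esub>"
    by (rule inj_onD) (use c X.cycles_zero in \<open>auto simp only: page_def\<close>)
  also have "\<dots> = ?BX"
    by (rule X.M.a_coset_join2) (simp_all only: X.boundaries_subgroup X.M.zero_closed zero)
  finally show ?thesis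
    using X.M.a_coset_join1 X.boundaries_subgroup X.cycles_in[OF c] by blast
qed

lemma lift_mod_boundaries_if_page_map_surj:
  assumes surj: "page_map (X, Y, f) (Suc k) p n ` page X (Suc k) p n = page Y (Suc k) p n"
    and y: "y \<in> cycles Y (Suc k) p n"
  shows "\<exists>x\<in>cycles X (Suc k) p n. \<exists>b\<in>boundaries Y (Suc k) p n. y = b \<oplus>\<^bsub>cobj Y n\<^esub> f n x"
proof -
  let ?BX = "boundaries X (Suc k) p n" and ?BY = "boundaries Y (Suc k) p n"
  have "?BY +>\<^bsub>cobj Y n\<^esub> y \<in> page Y (Suc k) p n"
    using y unfolding page_def by blast
  then obtain x where x: "x \<in> cycles X (Suc k) p n"
    and "?BY +>\<^bsub>cobj Y n\<^esub> y = page_map (X, Y, f) (Suc k) p n (?BX +>\<^bsub>cobj X n\<^esub> x)"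
    unfolding surj[symmetric] unfolding page_def[of X] by blast
  then have "?BY +>\<^bsub>cobj Y n\<^esub> y = ?BY +>\<^bsub>cobj Y n\<^esub> f n x" by (simp only: page_map_coset)
  moreover have "y \<in> ?BY +>\<^bsub>cobj Y n\<^esub> y"
    using Y.cycles_in[OF y] Y.boundaries_subgroup[of k p n, THEN subgroup.one_closed]
    unfolding a_r_coset_def' by force
  ultimately show ?thesis using x unfolding a_r_coset_def' by blast
qed

text \<open>The page controls elements only up to boundaries. Lifting of \<open>r\<close>-cycles
  moves the boundary error itself into \<open>X\<close>, which turns an equality of classes into an
  equality of elements.\<close>

lemma corrects_cycles_if_quasi_iso:
  assumes lift: "lifts_cycles r" and qi: "quasi_iso R r (X, Y, f)"
  shows "corrects_cycles r"
  unfolding corrects_cycles_def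
proof (intro allI ballI impI)
  fix p n c assume c: "c \<in> cfilt X (p - int r) (n + 1)"
    and dc: "cdiff X (n + 1) c = \<zero>\<^bsub>cobj X (n + 2)\<^esub>"
    and fc: "f (n + 1) c \<in> cfilt Y (p - int r - 1) (n + 1)"
  have [simp]: "c \<in> carrier (cobj X (n + 1))" using c by (rule X.filt_in)
  interpret DX: linear_map R "cobj X (n - 1)" "cobj X n" "cdiff X (n - 1)" by (rule X.diff_linear_map)
  interpret DY: linear_map R "cobj Y (n - 1)" "cobj Y n" "cdiff Y (n - 1)" by (rule Y.diff_linear_map)
  have inj: "inj_on (page_map (X, Y, f) (Suc r) p n) (page X (Suc r) p n)"
    and surj: "page_map (X, Y, f) (Suc r) p n ` page X (Suc r) p n = page Y (Suc r) p n" for p n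
    using qi by (auto simp: quasi_iso_def bij_betw_def)
  have dfc: "cdiff Y (n + 1) (f (n + 1) c) = \<zero>\<^bsub>cobj Y (n + 2)\<^esub>"
    using map_diff[of c "n + 1"] dc by (simp add: add.assoc)
  have "c \<in> cycles X (Suc r) (p - int r) (n + 1)"
    using c dc by (simp add: cycles_def add.assoc)
  moreover have "f (n + 1) c \<in> cycles Y r (p - int r - 1) (n + 1)"
    using fc dfc by (simp add: cycles_def add.assoc)
  \<comment> \<open>Injectivity on the page writes \<open>c\<close> as \<open>d w + u\<close>; surjectivity then makes \<open>f w = 0\<close> after
    subtracting from \<open>w\<close> an element \<open>e\<close> whose differential is of low filtration.\<close>
  ultimately have "c \<in> boundaries X (Suc r) (p - int r) (n + 1)"
    using boundaries_if_page_map_inj[OF inj] Y.cycles_subset_boundaries by blast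
  then obtain w u where w: "w \<in> cycles X r p n" and u: "u \<in> cycles X r (p - int r - 1) (n + 1)"
    and c_eq: "c = cdiff X n w \<oplus>\<^bsub>cobj X (n + 1)\<^esub> u"
    unfolding X.in_boundaries_Suc_iff by auto
  note [simp] = X.cycles_in Y.cycles_in
  have wu [simp]: "w \<in> carrier (cobj X n)" "u \<in> carrier (cobj X (n + 1))" using w u by auto
  have "f (n + 1) c = cdiff Y n (f n w) \<oplus>\<^bsub>cobj Y (n + 1)\<^esub> f (n + 1) u"
    by (simp add: c_eq map_diff)
  then have "cdiff Y n (f n w) = f (n + 1) c \<ominus>\<^bsub>cobj Y (n + 1)\<^esub> f (n + 1) u"
    by (metis wu F.closed Y.D.closed Y.M.add.inv_solve_right Y.M.a_closed a_minus_def)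
  \<comment> \<open>Both \<open>f c\<close> and \<open>f u\<close> lie in filtration
    \<open>p - r - 1\<close>. This promotes \<open>f w\<close> from an \<open>r\<close>-cycle to an
    \<open>r + 1\<close>-cycle, so it has a class on the page.\<close>
  then have "cdiff Y n (f n w) \<in> cfilt Y (p - int r - 1) (n + 1)"
    using fc u map_filt by (auto simp: cycles_def)
  then have "f n w \<in> cycles Y (Suc r) p n"
    using map_cycles[OF w] by (simp add: cycles_def algebra_simps)
  then obtain w1 b where w1: "w1 \<in> cycles X (Suc r) p n" and b: "b \<in> boundaries Y (Suc r) p n"
    and fw: "f n w = b \<oplus>\<^bsub>cobj Y n\<^esub> f n w1"
    using lift_mod_boundaries_if_page_map_surj[OF surj] by blast
  from b obtain y2 y3 where "y2 \<in> cycles Y r (p + int r) (n - 1)" "y3 \<in> cycles Y r (p - 1) n"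
    and b_eq: "b = cdiff Y (n - 1) y2 \<oplus>\<^bsub>cobj Y n\<^esub> y3"
    unfolding Y.in_boundaries_Suc_iff by auto
  \<comment> \<open>Both parts of the boundary \<open>b\<close> come from \<open>r\<close>-cycles of
    \<open>Y\<close>, and these can be lifted.\<close>
  with lift obtain w2 w3 where w2: "w2 \<in> cycles X r (p + int r) (n - 1)" "f (n - 1) w2 = y2"
    and w3: "w3 \<in> cycles X r (p - 1) n" "f n w3 = y3"
    unfolding lifts_cycles_def by metis
  have in_X [simp]: "w1 \<in> carrier (cobj X n)" "w2 \<in> carrier (cobj X (n - 1))" "w3 \<in> carrier (cobj X n)"
    using w1 w2 w3 by auto
  \<comment> \<open>\<open>e\<close> is a lift of \<open>f w\<close> of filtration \<open>p\<close>
    whose differential drops \<open>r + 1\<close> steps: \<open>w2\<close> contributes nothing since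
    \<open>d d = 0\<close>, \<open>w3\<close> starts one step lower and drops \<open>r\<close> more,
    and \<open>w1\<close> is an \<open>r + 1\<close>-cycle.\<close>
  define e where "e = cdiff X (n - 1) w2 \<oplus>\<^bsub>cobj X n\<^esub> w3 \<oplus>\<^bsub>cobj X n\<^esub> w1"
  have e_in [simp]: "e \<in> carrier (cobj X n)" by (simp add: e_def)
  have fe: "f n e = f n w"
    by (simp add: e_def fw b_eq map_diff' w2 w3)
  have "cdiff X (n - 1) w2 \<in> cfilt X p n"
    using w2(1) by (simp add: cycles_def)
  moreover have "w1 \<in> cfilt X p n" "w3 \<in> cfilt X p n"
    using w1 w3 by (auto simp: cycles_def intro: X.filt_mono)
  ultimately have "w \<ominus>\<^bsub>cobj X n\<^esub> e \<in> cfilt X p n"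
    using w by (auto simp: e_def cycles_def)
  moreover have "f n (w \<ominus>\<^bsub>cobj X n\<^esub> e) = \<zero>\<^bsub>cobj Y n\<^esub>"
    by (simp add: fe Y.M.r_neg a_minus_def)
  moreover have "c \<ominus>\<^bsub>cobj X (n + 1)\<^esub> cdiff X n (w \<ominus>\<^bsub>cobj X n\<^esub> e) \<in> cfilt X (p - int r - 1) (n + 1)"
  proof -
    have "cdiff X n (cdiff X (n - 1) w2) = \<zero>\<^bsub>cobj X (n + 1)\<^esub>"
      using X.diff_diff[of w2 "n - 1"] by (simp add: add.commute)
    then have "cdiff X n e = cdiff X n w3 \<oplus>\<^bsub>cobj X (n + 1)\<^esub> cdiff X n w1"
      by (simp add: e_def)
    moreover have "cdiff X n w3 \<in> cfilt X (p - int r - 1) (n + 1)"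
      "cdiff X n w1 \<in> cfilt X (p - int r - 1) (n + 1)"
      using w1 w3 by (simp_all add: cycles_def algebra_simps)
    moreover have "c \<ominus>\<^bsub>cobj X (n + 1)\<^esub> cdiff X n (w \<ominus>\<^bsub>cobj X n\<^esub> e) =
        u \<oplus>\<^bsub>cobj X (n + 1)\<^esub> cdiff X n e"
      by (simp add: c_eq a_minus_def X.M.minus_add X.M.a_ac X.M.r_neg X.M.r_neg1 X.M.r_neg2)
    moreover have "u \<in> cfilt X (p - int r - 1) (n + 1)" using u by (simp add: cycles_def)
    ultimately show ?thesis by auto
  qed
  ultimately show "\<exists>w\<in>cfilt X p n. f n w = \<zero>\<^bsub>cobj Y n\<^esub> \<and>
      c \<ominus>\<^bsub>cobj X (n + 1)\<^esub> cdiff X n w \<in> cfilt X (p - int r - 1) (n + 1)"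
    by blast
qed

end

section \<open>Maps out of the complex \<open>Q\<^sub>r\<bbbS>\<close>\<close>

definition lincomb :: "('r, 'e) ring_scheme \<Rightarrow> ('r, 'x, 'm) module_scheme \<Rightarrow> (nat \<Rightarrow> 'x) \<Rightarrow> (nat \<Rightarrow> 'r) \<Rightarrow> 'x" where
  "lincomb R M x c = finsum M (\<lambda>i. c i \<odot>\<^bsub>M\<^esub> x i) {i. c i \<noteq> \<zero>\<^bsub>R\<^esub>}"

lemma (in cring) free_module_module: "module R (free_module R I)"
proof (rule moduleI)
  show "abelian_group (free_module R I)"
  proof (rule abelian_groupI)
    fix c assume "c \<in> carrier (free_module R I)"
    then show "\<exists>d\<in>carrier (free_module R I). d \<oplus>\<^bsub>free_module R I\<^esub> c = \<zero>\<^bsub>free_module R I\<^esub>"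
      by (intro bexI[of _ "\<lambda>i. \<ominus> c i"])
        (auto simp: free_module_def fun_eq_iff l_neg image_subset_iff elim!: rev_finite_subset)
  next
    fix c d assume "c \<in> carrier (free_module R I)" "d \<in> carrier (free_module R I)"
    moreover from this have "finite ({i. c i \<noteq> \<zero>} \<union> {i. d i \<noteq> \<zero>})" by (simp add: free_module_def)
    then have "finite {i. c i \<oplus> d i \<noteq> \<zero>}" by (rule rev_finite_subset) auto
    ultimately show "c \<oplus>\<^bsub>free_module R I\<^esub> d \<in> carrier (free_module R I)"
      by (auto simp: free_module_def image_subset_iff)
  qed (auto simp: free_module_def fun_eq_iff image_subset_iff intro: a_assoc a_comm)
next
  fix a c assume "a \<in> carrier R" "c \<in> carrier (free_module R I)"
  then show "a \<odot>\<^bsub>free_module R I\<^esub> c \<in> carrier (free_module R I)"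
    by (auto simp: free_module_def image_subset_iff elim!: rev_finite_subset)
qed (auto simp: free_module_def fun_eq_iff image_subset_iff l_distr r_distr m_assoc is_cring)

lemma (in cring) basis_in_free_module: "i \<in> I \<Longrightarrow> basis R i \<in> carrier (free_module R I)"
  by (auto simp: basis_def free_module_def)

context module
begin

lemma free_moduleD:
  assumes "c \<in> carrier (free_module R I)"
  shows "c i \<in> carrier R" "finite {i. c i \<noteq> \<zero>}" "i \<notin> I \<Longrightarrow> c i = \<zero>"
  using assms by (auto simp: free_module_def)

text \<open>Terms outside the support vanish. This lets combinations with different supports be
  summed over one common finite set.\<close>

lemma lincomb_eq_finsum:
  assumes c: "c \<in> carrier (free_module R I)" and x: "\<And>i. x i \<in> carrier M"
    and T: "finite T" "{i. c i \<noteq> \<zero>} \<subseteq> T"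
  shows "lincomb R M x c = finsum M (\<lambda>i. c i \<odot>\<^bsub>M\<^esub> x i) T"
  unfolding lincomb_def
  by (rule M.add.finprod_mono_neutral_cong_left) (use assms free_moduleD(1)[OF c] in auto)

lemma lincomb_closed:
  assumes c: "c \<in> carrier (free_module R I)" and x: "\<And>i. x i \<in> carrier M"
  shows "lincomb R M x c \<in> carrier M"
  unfolding lincomb_def using free_moduleD(1)[OF c] x by (auto intro!: M.finsum_closed)

lemma lincomb_add:
  assumes c: "c \<in> carrier (free_module R I)" and x: "\<And>i. x i \<in> carrier M" and y: "\<And>i. y i \<in> carrier M"
  shows "lincomb R M (\<lambda>i. x i \<oplus>\<^bsub>M\<^esub> y i) c = lincomb R M x c \<oplus>\<^bsub>M\<^esub> lincomb R M y c"
proof -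
  have "lincomb R M (\<lambda>i. x i \<oplus>\<^bsub>M\<^esub> y i) c =
      (\<Oplus>\<^bsub>M\<^esub>i\<in>{i. c i \<noteq> \<zero>}. c i \<odot>\<^bsub>M\<^esub> x i \<oplus>\<^bsub>M\<^esub> c i \<odot>\<^bsub>M\<^esub> y i)"
    unfolding lincomb_def using free_moduleD(1)[OF c] x y
    by (intro M.finsum_cong') (auto simp: smult_r_distr)
  also have "\<dots> = lincomb R M x c \<oplus>\<^bsub>M\<^esub> lincomb R M y c"
    unfolding lincomb_def using free_moduleD(1)[OF c] x y by (subst M.finsum_addf) auto
  finally show ?thesis .
qed

text \<open>Summation by parts: the coefficients on the left are those of the differential of
  \<open>Q_complex\<close>, and the shift moves from them to the vectors. Index zero has coefficient
  zero on the left and contributes nothing on the right since \<open>x 0\<close> vanishes.\<close>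

lemma lincomb_shift:
  assumes c: "c \<in> carrier (free_module R UNIV)" and x: "\<And>i. x i \<in> carrier M" and x0: "x 0 = \<zero>\<^bsub>M\<^esub>"
  shows "lincomb R M x (\<lambda>j. if j = 0 then \<zero> else c (j - 1) \<oplus> c j) =
    lincomb R M (\<lambda>i. x i \<oplus>\<^bsub>M\<^esub> x (Suc i)) c"
proof -
  note cD = free_moduleD[OF c]
  let ?c = "\<lambda>j. if j = 0 then \<zero> else c (j - 1) \<oplus> c j"
  obtain N where N: "{i. c i \<noteq> \<zero>} \<subseteq> {..N}"
    using cD(2) unfolding finite_nat_set_iff_bounded_le by blast
  then have c0: "c i = \<zero>" if "N < i" for i using that by force
  \<comment> \<open>The shifted copy of \<open>c\<close> extends the support by one index, hence
    \<open>Suc N\<close>.\<close>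
  have supp: "{j. ?c j \<noteq> \<zero>} \<subseteq> {..Suc N}"
  proof (rule subsetI, rule ccontr)
    fix j assume "j \<in> {j. ?c j \<noteq> \<zero>}" "j \<notin> {..Suc N}"
    then show False using c0[of j] c0[of "j - 1"] by simp
  qed
  have c': "?c \<in> carrier (free_module R UNIV)"
    using cD(1) finite_subset[OF supp] by (auto simp: free_module_def image_subset_iff)
  have "lincomb R M x ?c = (\<Oplus>\<^bsub>M\<^esub>j\<in>{..Suc N}. ?c j \<odot>\<^bsub>M\<^esub> x j)"
    by (rule lincomb_eq_finsum[OF c' x _ supp]) simp
  also have "\<dots> = (\<Oplus>\<^bsub>M\<^esub>i\<in>{..N}. (c i \<oplus> c (Suc i)) \<odot>\<^bsub>M\<^esub> x (Suc i))"
    using cD(1) x by (subst M.finsum_Suc2) (auto intro!: M.finsum_closed)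
  also have "\<dots> = (\<Oplus>\<^bsub>M\<^esub>i\<in>{..N}. c i \<odot>\<^bsub>M\<^esub> x (Suc i) \<oplus>\<^bsub>M\<^esub> c (Suc i) \<odot>\<^bsub>M\<^esub> x (Suc i))"
    using cD(1) x by (intro M.finsum_cong') (auto simp: smult_l_distr)
  also have "\<dots> = (\<Oplus>\<^bsub>M\<^esub>i\<in>{..N}. c i \<odot>\<^bsub>M\<^esub> x (Suc i)) \<oplus>\<^bsub>M\<^esub> (\<Oplus>\<^bsub>M\<^esub>i\<in>{..N}. c (Suc i) \<odot>\<^bsub>M\<^esub> x (Suc i))"
    using cD(1) x by (intro M.finsum_addf) auto
  also have "(\<Oplus>\<^bsub>M\<^esub>i\<in>{..N}. c i \<odot>\<^bsub>M\<^esub> x (Suc i)) = lincomb R M (\<lambda>i. x (Suc i)) c"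
    by (rule lincomb_eq_finsum[OF c x _ N, symmetric]) simp
  \<comment> \<open>Reindexed, the sum runs from 1 to \<open>Suc N\<close>; the term at zero may be
    added because it vanishes by \<open>x0\<close>.\<close>
  also have "(\<Oplus>\<^bsub>M\<^esub>i\<in>{..N}. c (Suc i) \<odot>\<^bsub>M\<^esub> x (Suc i)) = (\<Oplus>\<^bsub>M\<^esub>i\<in>{..Suc N}. c i \<odot>\<^bsub>M\<^esub> x i)"
    using cD(1) x by (subst M.finsum_Suc2) (auto simp: x0 intro!: M.finsum_closed)
  also have "\<dots> = lincomb R M x c"
    using N by (intro lincomb_eq_finsum[OF c x, symmetric]) auto
  finally show ?thesis
    using lincomb_add[OF c x, of "\<lambda>i. x (Suc i)"] lincomb_closed[OF c x] lincomb_closed[OF c, of "\<lambda>i. x (Suc i)"] x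
    by (simp add: M.a_comm)
qed

end

lemma lincomb_linear:
  fixes R (structure)
  assumes M: "module R M" and x: "\<And>i. x i \<in> carrier M"
  shows "lincomb R M x \<in> linear_maps R (free_module R I) M"
proof (rule linear_mapsI)
  interpret module R M by (rule M)
  interpret F: module R "free_module R I" by (rule R.free_module_module)
  fix c assume c: "c \<in> carrier (free_module R I)"
  then show "lincomb R M x c \<in> carrier M" using x by (rule lincomb_closed)
  note cD = free_moduleD[OF c]
  {
    fix d assume d: "d \<in> carrier (free_module R I)"
    note dD = free_moduleD[OF d]
    \<comment> \<open>The support of a sum can be smaller than either support, so all three sums are
      taken over the union.\<close>
    let ?T = "{i. c i \<noteq> \<zero>} \<union> {i. d i \<noteq> \<zero>}"
    have T: "finite ?T" using cD dD by simp
    have "lincomb R M x (c \<oplus>\<^bsub>free_module R I\<^esub> d) =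
        (\<Oplus>\<^bsub>M\<^esub>i\<in>?T. (c \<oplus>\<^bsub>free_module R I\<^esub> d) i \<odot>\<^bsub>M\<^esub> x i)"
      by (rule lincomb_eq_finsum[OF F.a_closed[OF c d] x T])
        (auto simp: free_module_def)
    also have "\<dots> = (\<Oplus>\<^bsub>M\<^esub>i\<in>?T. c i \<odot>\<^bsub>M\<^esub> x i \<oplus>\<^bsub>M\<^esub> d i \<odot>\<^bsub>M\<^esub> x i)"
      using cD dD x by (intro M.finsum_cong') (auto simp: free_module_def smult_l_distr)
    also have "\<dots> = lincomb R M x c \<oplus>\<^bsub>M\<^esub> lincomb R M x d"
      using cD dD x
      by (subst M.finsum_addf) (auto simp: lincomb_eq_finsum[OF c x T] lincomb_eq_finsum[OF d x T])
    finally show "lincomb R M x (c \<oplus>\<^bsub>free_module R I\<^esub> d) = lincomb R M x c \<oplus>\<^bsub>M\<^esub> lincomb R M x d" .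
  }
  fix a assume a: "a \<in> carrier R"
  have "lincomb R M x (a \<odot>\<^bsub>free_module R I\<^esub> c) =
      (\<Oplus>\<^bsub>M\<^esub>i\<in>{i. c i \<noteq> \<zero>}. (a \<odot>\<^bsub>free_module R I\<^esub> c) i \<odot>\<^bsub>M\<^esub> x i)"
    by (rule lincomb_eq_finsum[OF F.smult_closed[OF a c] x cD(2)])
      (auto simp: free_module_def a)
  also have "\<dots> = (\<Oplus>\<^bsub>M\<^esub>i\<in>{i. c i \<noteq> \<zero>}. a \<odot>\<^bsub>M\<^esub> (c i \<odot>\<^bsub>M\<^esub> x i))"
    using cD x a by (intro M.finsum_cong') (auto simp: free_module_def smult_assoc1)
  also have "\<dots> = a \<odot>\<^bsub>M\<^esub> lincomb R M x c"
    unfolding lincomb_def using cD x a by (subst finsum_smult_ldistr) auto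
  finally show "lincomb R M x (a \<odot>\<^bsub>free_module R I\<^esub> c) = a \<odot>\<^bsub>M\<^esub> lincomb R M x c" .
qed

lemma (in linear_map) lincomb_image:
  assumes c: "c \<in> carrier (free_module R I)" and x: "\<And>i. x i \<in> carrier M"
  shows "f (lincomb R M x c) = lincomb R N (\<lambda>i. f (x i)) c"
proof -
  note cD = M.free_moduleD[OF c]
  show ?thesis unfolding lincomb_def
    using cD x by (subst finsum) (auto intro!: N.finsum_cong')
qed

text \<open>Checked coordinate by coordinate. Outside \<open>I\<close> the zero vector replaces
  \<open>basis R i\<close>, which need not lie in the module there.\<close>

lemma (in cring) lincomb_basis:
  assumes c: "c \<in> carrier (free_module R I)"
  shows "lincomb R (free_module R I) (\<lambda>i. if i \<in> I then basis R i else \<zero>\<^bsub>free_module R I\<^esub>) c = c"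
    (is "lincomb R ?F ?b c = c")
proof -
  interpret F: module R ?F by (rule free_module_module)
  note cD = F.free_moduleD[OF c]
  have b: "?b i \<in> carrier ?F" for i by (simp add: basis_in_free_module)
  \<comment> \<open>Evaluation at \<open>j\<close> is additive, so it passes through finite
    sums.\<close>
  have coord: "finsum ?F g T j = (\<Oplus>i\<in>T. g i j)" if "g \<in> T \<rightarrow> carrier ?F" "finite T" for g T j
    using that(2,1)
  proof (induction T rule: finite_induct)
    case empty
    have "\<zero>\<^bsub>?F\<^esub> j = \<zero>" by (simp add: free_module_def)
    then show ?case by simp
  next
    case (insert a T)
    then have *: "g \<in> T \<rightarrow> carrier ?F" "g a \<in> carrier ?F" by auto
    then have "(\<lambda>i. g i j) \<in> T \<rightarrow> carrier R" "g a j \<in> carrier R"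
      using F.free_moduleD(1) by blast+
    with * insert show ?case
      by (simp add: F.finsum_insert) (simp add: free_module_def)
  qed
  show ?thesis
  proof
    fix j
    let ?T = "{i. c i \<noteq> \<zero>}"
    have "lincomb R ?F ?b c j = (\<Oplus>i\<in>?T. (c i \<odot>\<^bsub>?F\<^esub> ?b i) j)"
      unfolding lincomb_def by (rule coord) (use cD b in auto)
    also have "\<dots> = (\<Oplus>i\<in>?T. if j = i then c i else \<zero>)"
      using cD by (intro finsum_cong') (auto simp: free_module_def basis_def)
    also have "\<dots> = c j"
    proof (cases "j \<in> ?T")
      case True
      then show ?thesis using cD by (intro finsum_singleton) auto
    next
      case False
      then have "(\<Oplus>i\<in>?T. if j = i then c i else \<zero>) = (\<Oplus>i\<in>?T. \<zero>)"
        by (intro finsum_cong') auto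
      with False show ?thesis by (simp add: finsum_zero)
    qed
    finally show "lincomb R ?F ?b c j = c j" .
  qed
qed

text \<open>Apply \<open>g\<close> to the expansion of \<open>c\<close> in the basis. Together with
  \<open>lincomb_linear\<close> this is the universal property of the free module.\<close>

lemma linear_map_eq_lincomb:
  fixes R (structure)
  assumes M: "module R M" and g: "g \<in> linear_maps R (free_module R I) M" and c: "c \<in> carrier (free_module R I)"
  shows "g c = lincomb R M (\<lambda>i. if i \<in> I then g (basis R i) else \<zero>\<^bsub>M\<^esub>) c"
proof -
  interpret module R M by (rule M)
  interpret F: module R "free_module R I" by (rule R.free_module_module)
  interpret G: linear_map R "free_module R I" M g
    by unfold_locales (rule g)
  let ?b = "\<lambda>i. if i \<in> I then basis R i else \<zero>\<^bsub>free_module R I\<^esub>"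
  have "g c = g (lincomb R (free_module R I) ?b c)"
    by (simp only: R.lincomb_basis[OF c])
  also have "\<dots> = lincomb R M (\<lambda>i. g (?b i)) c"
    by (rule G.lincomb_image[OF c]) (simp add: R.basis_in_free_module)
  finally show ?thesis by (simp add: if_distrib cong: if_cong)
qed

section \<open>The complex \<open>Q_complex\<close> and its universal property\<close>

lemma (in cring) filtered_complex_Q: "filtered_complex R (Q_complex R r)"
  unfolding filtered_complex_def
proof (intro conjI allI ballI)
  fix n :: int
  interpret F: module R "free_module R (Q_index n)" by (rule free_module_module)
  have F: "cobj (Q_complex R r) n = free_module R (Q_index n)" for n by (simp add: Q_complex_def)
  have D: "cdiff (Q_complex R r) n c = (if n = 0 then (\<lambda>j. if j = 0 then \<zero> else c (j - 1) \<oplus> c j)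
    else (\<lambda>_. \<zero>))" for n c by (simp add: Q_complex_def)
  show "module R (cobj (Q_complex R r) n)" unfolding F by unfold_locales
  have D_in: "cdiff (Q_complex R r) n c \<in> carrier (cobj (Q_complex R r) (n + 1))"
    if c: "c \<in> carrier (cobj (Q_complex R r) n)" for c
  proof -
    from c have cD: "range c \<subseteq> carrier R" "finite {i. c i \<noteq> \<zero>}" by (simp_all add: F free_module_def)
    have "finite ({i. c i \<noteq> \<zero>} \<union> Suc ` {i. c i \<noteq> \<zero>})" using cD by simp
    moreover have "{j. (if j = 0 then \<zero> else c (j - 1) \<oplus> c j) \<noteq> \<zero>} \<subseteq>
        {i. c i \<noteq> \<zero>} \<union> Suc ` {i. c i \<noteq> \<zero>}"
    proof
      fix j assume "j \<in> {j. (if j = 0 then \<zero> else c (j - 1) \<oplus> c j) \<noteq> \<zero>}"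
      then show "j \<in> {i. c i \<noteq> \<zero>} \<union> Suc ` {i. c i \<noteq> \<zero>}" by (cases j) (auto split: if_splits)
    qed
    ultimately have "finite {j. (if j = 0 then \<zero> else c (j - 1) \<oplus> c j) \<noteq> \<zero>}"
      by (rule rev_finite_subset)
    then show ?thesis
      using cD by (auto simp: F D free_module_def Q_index_def image_subset_iff)
  qed
  show "cdiff (Q_complex R r) n \<in> linear_maps R (cobj (Q_complex R r) n) (cobj (Q_complex R r) (n + 1))"
  proof (rule linear_mapsI[OF D_in])
    fix c d assume "c \<in> carrier (cobj (Q_complex R r) n)" "d \<in> carrier (cobj (Q_complex R r) n)"
    then have "c i \<in> carrier R" "d i \<in> carrier R" for i by (auto simp: F dest: F.free_moduleD(1))
    then show "cdiff (Q_complex R r) n (c \<oplus>\<^bsub>cobj (Q_complex R r) n\<^esub> d) =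
        cdiff (Q_complex R r) n c \<oplus>\<^bsub>cobj (Q_complex R r) (n + 1)\<^esub> cdiff (Q_complex R r) n d"
      by (simp add: F D free_module_def fun_eq_iff a_ac)
  next
    fix a c assume "a \<in> carrier R" "c \<in> carrier (cobj (Q_complex R r) n)"
    moreover from this have "c i \<in> carrier R" for i by (auto simp: F dest: F.free_moduleD(1))
    ultimately show "cdiff (Q_complex R r) n (a \<odot>\<^bsub>cobj (Q_complex R r) n\<^esub> c) =
        a \<odot>\<^bsub>cobj (Q_complex R r) (n + 1)\<^esub> cdiff (Q_complex R r) n c"
      by (simp add: F D free_module_def fun_eq_iff r_distr)
  qed
  show "cdiff (Q_complex R r) (n + 1) (cdiff (Q_complex R r) n c) = \<zero>\<^bsub>cobj (Q_complex R r) (n + 2)\<^esub>"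
    for c by (auto simp: F D free_module_def fun_eq_iff)
  fix p :: int
  have filt: "cfilt (Q_complex R r) p n = {f \<in> carrier (free_module R (Q_index n)).
      \<forall>i. f i \<noteq> \<zero> \<longrightarrow> Q_weight r n i \<le> p}" for p n
    by (simp add: Q_complex_def)
  show "submodule (cfilt (Q_complex R r) p n) R (cobj (Q_complex R r) n)"
    unfolding F
  proof (rule F.submoduleI_smult)
    fix a b assume ab: "a \<in> cfilt (Q_complex R r) p n" "b \<in> cfilt (Q_complex R r) p n"
    have "Q_weight r n i \<le> p" if "a i \<oplus> b i \<noteq> \<zero>" for i
    proof -
      have "a i \<noteq> \<zero> \<or> b i \<noteq> \<zero>" using that by auto
      with ab show ?thesis by (auto simp: filt)
    qed
    with ab show "a \<oplus>\<^bsub>free_module R (Q_index n)\<^esub> b \<in> cfilt (Q_complex R r) p n"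
      using F.a_closed[of a b] unfolding filt by (auto simp: free_module_def)
  next
    fix a x assume ax: "a \<in> carrier R" "x \<in> cfilt (Q_complex R r) p n"
    have "Q_weight r n i \<le> p" if "a \<otimes> x i \<noteq> \<zero>" for i
    proof -
      have "x i \<noteq> \<zero>" using that ax(1) by auto
      with ax show ?thesis by (auto simp: filt)
    qed
    with ax show "a \<odot>\<^bsub>free_module R (Q_index n)\<^esub> x \<in> cfilt (Q_complex R r) p n"
      using F.smult_closed[of a x] unfolding filt by (auto simp: free_module_def)
  qed (auto simp: filt free_module_def)
  show "cdiff (Q_complex R r) n ` cfilt (Q_complex R r) p n \<subseteq> cfilt (Q_complex R r) p (n + 1)"
  proof
    fix y assume "y \<in> cdiff (Q_complex R r) n ` cfilt (Q_complex R r) p n"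
    then obtain c where c: "c \<in> carrier (free_module R (Q_index n))"
      and w: "\<And>i. c i \<noteq> \<zero> \<Longrightarrow> Q_weight r n i \<le> p" and y: "y = cdiff (Q_complex R r) n c"
      by (auto simp: filt)
    have "Q_weight r (n + 1) j \<le> p" if "y j \<noteq> \<zero>" for j
    proof -
      have n: "n = 0" and j: "j > 0" and "c (j - 1) \<oplus> c j \<noteq> \<zero>"
        using that by (auto simp: y D split: if_splits)
      \<comment> \<open>A nonzero coefficient at \<open>j\<close> forces a nonzero coefficient of
        \<open>c\<close> at some \<open>i \<le> j\<close>, and then
        \<open>- r - j \<le> - i \<le> p\<close>.\<close>
      then have "c (j - 1) \<noteq> \<zero> \<or> c j \<noteq> \<zero>" by auto
      then obtain i where "c i \<noteq> \<zero>" "i \<le> j" by (metis diff_le_self order_refl)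
      with w[of i] n show ?thesis by (simp add: Q_weight_def)
    qed
    then show "y \<in> cfilt (Q_complex R r) p (n + 1)"
      using D_in c unfolding filt y F by auto
  qed
  show "cfilt (Q_complex R r) p n \<subseteq> cfilt (Q_complex R r) (p + 1) n"
    by (auto simp: filt)
qed

lemma (in cring) filtered_complex_zero: "filtered_complex R (zero_complex R)"
proof -
  have Z: "module R (rank_one R False)"
    by (rule moduleI, rule is_cring, rule abelian_groupI) (auto simp: rank_one_def)
  interpret Z: module R "rank_one R False" by (rule Z)
  have "submodule {\<zero>} R (rank_one R False)"
    by (rule Z.submoduleI_smult) (auto simp: rank_one_def)
  then show ?thesis
    using Z by (auto simp: filtered_complex_def zero_complex_def rank_one_def intro!: linear_mapsI)
qed

lemma (in filtered_cx) fc_morphism_from_zero: "fc_morphism R (from_zero R A)"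
  by (simp add: fc_morphism_def from_zero_def filtered_complex_zero filtered_complex zero_fc_hom)

text \<open>The existence half of the universal property. Degree one has no generator of index zero,
  so \<open>y 0\<close> is padding that makes \<open>dx\<close> uniform in \<open>i\<close>.
  Compatibility with the differential in degree zero is \<open>lincomb_shift\<close>.\<close>

lemma (in filtered_cx) Q_complex_hom:
  assumes x: "\<And>i. x i \<in> cfilt A (- int i) 0" and y: "\<And>i. y i \<in> cfilt A (- int r - int i) 1"
    and y0: "y 0 = \<zero>\<^bsub>cobj A 1\<^esub>" and dy: "\<And>i. cdiff A 1 (y i) = \<zero>\<^bsub>cobj A 2\<^esub>"
    and dx: "\<And>i. cdiff A 0 (x i) = y i \<oplus>\<^bsub>cobj A 1\<^esub> y (Suc i)"
  shows "(\<lambda>n c. if n = 0 then lincomb R (cobj A 0) x c else if n = 1 then lincomb R (cobj A 1) y c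
      else \<zero>\<^bsub>cobj A n\<^esub>) \<in> fc_hom R (Q_complex R r) A" (is "?h \<in> _")
proof -
  have x_in: "x i \<in> carrier (cobj A 0)" and y_in: "y i \<in> carrier (cobj A 1)" for i
    using x[of i] y[of i] by auto
  have F: "cobj (Q_complex R r) n = free_module R (Q_index n)" for n by (simp add: Q_complex_def)
  have D: "cdiff (Q_complex R r) n c = (if n = 0 then (\<lambda>j. if j = 0 then \<zero> else c (j - 1) \<oplus> c j)
    else (\<lambda>_. \<zero>))" for n c by (simp add: Q_complex_def)
  have lin: "?h n \<in> linear_maps R (free_module R (Q_index n)) (cobj A n)" for n
  proof -
    have "lincomb R (cobj A 0) x \<in> linear_maps R (free_module R (Q_index 0)) (cobj A 0)"
      "lincomb R (cobj A 1) y \<in> linear_maps R (free_module R (Q_index 1)) (cobj A 1)"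
      by (rule lincomb_linear[OF M.module_axioms], rule x_in y_in)+
    moreover have "(\<lambda>c. \<zero>\<^bsub>cobj A n\<^esub>) \<in> linear_maps R (free_module R (Q_index n)) (cobj A n)"
      by (auto intro!: linear_mapsI)
    ultimately show ?thesis by (cases "n = 0"; cases "n = 1") simp_all
  qed
  have diff: "?h (n + 1) (cdiff (Q_complex R r) n c) = cdiff A n (?h n c)"
    if c: "c \<in> carrier (free_module R (Q_index n))" for n c
  proof -
    have D0: "linear_map R (cobj A 0) (cobj A 1) (cdiff A 0)"
      and D1: "linear_map R (cobj A 1) (cobj A 2) (cdiff A 1)"
      using D.linear_map_axioms[of 0] D.linear_map_axioms[of 1] by simp_all
    have zero: "lincomb R (cobj A m) z (\<lambda>_. \<zero>) = \<zero>\<^bsub>cobj A m\<^esub>" for m z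
      by (simp add: lincomb_def)
    \<comment> \<open>Degree \<open>-1\<close> is separate because the map in the next degree is a
      linear combination, to be evaluated at the zero function.\<close>
    consider "n = 0" | "n = 1" | "n = -1" | "n \<noteq> 0 \<and> n \<noteq> 1 \<and> n \<noteq> -1" by blast
    then show ?thesis
    proof cases
      case 1
      then have "c \<in> carrier (free_module R UNIV)" using c by (simp add: Q_index_def)
      then show ?thesis
        using linear_map.lincomb_image[where x = x, OF D0 _ x_in] M.lincomb_shift[where x = y, OF _ y_in y0]
        by (simp add: 1 D dx)
    next
      case 2
      have "lincomb R (cobj A 2) (\<lambda>_. \<zero>\<^bsub>cobj A 2\<^esub>) c = \<zero>\<^bsub>cobj A 2\<^esub>"
        unfolding lincomb_def using M.free_moduleD(1)[OF c]
        by (subst M.finsum_cong'[OF refl, of "\<lambda>_. \<zero>\<^bsub>cobj A 2\<^esub>"]) auto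
      with 2 show ?thesis
        using linear_map.lincomb_image[where x = y, OF D1 c y_in] by (simp add: D dy)
    next
      case 3
      then show ?thesis using D.zero[of "-1"] by (simp add: D zero)
    next
      case 4
      then show ?thesis by (simp add: D)
    qed
  qed
  have lincomb_filt: "lincomb R (cobj A n) z c \<in> cfilt A p n"
    if "c \<in> carrier (free_module R I)" "\<And>i. c i \<noteq> \<zero> \<Longrightarrow> z i \<in> cfilt A p n" for n p z c I
    unfolding lincomb_def using that M.free_moduleD(1)[OF that(1)]
    by (intro filt_finsum) auto
  have "?h n c \<in> cfilt A p n" if c: "c \<in> cfilt (Q_complex R r) p n" for n p c
  proof -
    have cF: "c \<in> carrier (free_module R (Q_index n))"
      and w: "\<And>i. c i \<noteq> \<zero> \<Longrightarrow> Q_weight r n i \<le> p"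
      using c by (auto simp: Q_complex_def)
    consider "n = 0" | "n = 1" | "n \<noteq> 0 \<and> n \<noteq> 1" by blast
    then show ?thesis
    proof cases
      case 1
      then show ?thesis
        using lincomb_filt[OF cF, of x] w filt_mono[OF x] by (auto simp: Q_weight_def)
    next
      case 2
      then show ?thesis
        using lincomb_filt[OF cF, of y] w filt_mono[OF y] by (auto simp: Q_weight_def)
    qed auto
  qed
  with lin diff show ?thesis unfolding fc_hom_def F by blast
qed

section \<open>Lifting maps out of \<open>Q_complex\<close>\<close>

context filtered_map
begin

text \<open>One step of the induction: \<open>b\<close> is the cycle lifted so far, and
  \<open>y\<close> and \<open>b'\<close> are the next targets in degrees \<open>n\<close> and
  \<open>n + 1\<close>. Subtracting an element of the kernel of \<open>f\<close> changes the
  differential of \<open>z\<close> without disturbing \<open>f z = y\<close>.\<close>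

lemma lift_step:
  assumes lift: "lifts_cycles r" and corr: "corrects_cycles r"
    and y: "y \<in> cfilt Y p n" and b: "b \<in> cfilt X (p - int r) (n + 1)"
    and db: "cdiff X (n + 1) b = \<zero>\<^bsub>cobj X (n + 2)\<^esub>"
    and b': "b' \<in> cfilt Y (p - int r - 1) (n + 1)"
    and dy: "cdiff Y n y = f (n + 1) b \<oplus>\<^bsub>cobj Y (n + 1)\<^esub> b'"
  shows "\<exists>x\<in>cfilt X p n. \<exists>c\<in>cfilt X (p - int r - 1) (n + 1).
    f n x = y \<and> f (n + 1) c = b' \<and> cdiff X n x = b \<oplus>\<^bsub>cobj X (n + 1)\<^esub> c"
proof -
  note [simp] = X.filt_in[OF b] Y.filt_in[OF b'] Y.filt_in[OF y]
  \<comment> \<open>Both summands in \<open>dy\<close> then lie in filtration \<open>p - r\<close>,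
    so \<open>y\<close> is an \<open>r\<close>-cycle.\<close>
  have "b' \<in> cfilt Y (p - int r) (n + 1)" using b' by (rule Y.filt_mono) simp
  then have "y \<in> cycles Y r p n"
    using y map_filt[OF b] by (auto simp: cycles_def dy)
  with lift obtain z where "z \<in> cycles X r p n" and fz: "f n z = y"
    unfolding lifts_cycles_def by blast
  then have z: "z \<in> cfilt X p n" "cdiff X n z \<in> cfilt X (p - int r) (n + 1)"
    by (auto simp: cycles_def)
  note [simp] = X.filt_in[OF z(1)]
  define c where "c = cdiff X n z \<ominus>\<^bsub>cobj X (n + 1)\<^esub> b"
  have c: "c \<in> cfilt X (p - int r) (n + 1)" using z b by (auto simp: c_def)
  have dc: "cdiff X (n + 1) c = \<zero>\<^bsub>cobj X (n + 2)\<^esub>"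
    using X.D.minus[of "cdiff X n z" "n + 1" b] X.diff_diff[of z n] db
    by (simp add: c_def add.assoc a_minus_def)
  have fc: "f (n + 1) c = b'"
    by (simp add: c_def map_diff fz dy a_minus_def Y.M.a_ac Y.M.r_neg1 Y.M.r_neg2 Y.M.r_neg)
  with corr c dc b' obtain w where w: "w \<in> cfilt X p n" "f n w = \<zero>\<^bsub>cobj Y n\<^esub>"
    and cw: "c \<ominus>\<^bsub>cobj X (n + 1)\<^esub> cdiff X n w \<in> cfilt X (p - int r - 1) (n + 1)"
    unfolding corrects_cycles_def by blast
  note [simp] = X.filt_in[OF w(1)] w(2) X.filt_in[OF c]
  show ?thesis
  proof (intro bexI conjI)
    show "f n (z \<ominus>\<^bsub>cobj X n\<^esub> w) = y" by (simp add: fz a_minus_def)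
    have "f (n + 1) (cdiff X n w) = \<zero>\<^bsub>cobj Y (n + 1)\<^esub>" by (simp add: map_diff)
    then show "f (n + 1) (c \<ominus>\<^bsub>cobj X (n + 1)\<^esub> cdiff X n w) = b'"
      by (simp add: fc a_minus_def)
    show "cdiff X n (z \<ominus>\<^bsub>cobj X n\<^esub> w) =
        b \<oplus>\<^bsub>cobj X (n + 1)\<^esub> (c \<ominus>\<^bsub>cobj X (n + 1)\<^esub> cdiff X n w)"
    proof -
      have "b \<oplus>\<^bsub>cobj X (n + 1)\<^esub> c = cdiff X n z"
        by (simp add: c_def a_minus_def X.M.a_lcomm[of b] X.M.r_neg)
      then show ?thesis by (simp add: a_minus_def flip: X.M.a_assoc)
    qed
  qed (use z w cw in auto)
qed

text \<open>Each application of \<open>lift_step\<close> starts from the cycle found by the previous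
  one, so the sequences arise by dependent choice. They define the lift through
  \<open>Q_complex_hom\<close>.\<close>

lemma Q_complex_lifts:
  assumes lift: "lifts_cycles r" and corr: "corrects_cycles r"
  shows "lifts_against R (from_zero R (Q_complex R r)) (X, Y, f)"
  unfolding lifts_against_def from_zero_def prod.case
proof (intro ballI impI)
  fix u v assume u: "u \<in> fc_hom R (zero_complex R) X" and v: "v \<in> fc_hom R (Q_complex R r) Y"
  have F: "cobj (Q_complex R r) n = free_module R (Q_index n)" for n by (simp add: Q_complex_def)
  have Fm: "module R (free_module R (Q_index n))" for n by (rule free_module_module)
  have V: "linear_map R (free_module R (Q_index n)) (cobj Y n) (v n)" for n
    using v Fm F by (auto intro!: linear_map.intro linear_map_axioms.intro simp: fc_hom_def Y.M.module_axioms)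
  define \<alpha> where "\<alpha> i = v 0 (basis R i)" for i
  \<comment> \<open>The value zero at index zero lets \<open>d\<alpha>\<close> cover the generator
    of index zero, whose differential has a single term.\<close>
  define \<beta> where "\<beta> i = (if 1 \<le> i then v 1 (basis R i) else \<zero>\<^bsub>cobj Y 1\<^esub>)" for i
  have b0: "basis R i \<in> carrier (free_module R (Q_index 0))" for i
    by (simp add: Q_index_def basis_in_free_module)
  have b1: "basis R i \<in> carrier (free_module R (Q_index 1))" if "1 \<le> i" for i
    using that by (simp add: Q_index_def basis_in_free_module)
  have \<alpha>: "\<alpha> i \<in> cfilt Y (- int i) 0" for i
    unfolding \<alpha>_def
    by (rule fc_hom_filt[OF v]) (use b0 in \<open>auto simp: Q_complex_def Q_weight_def basis_def\<close>)
  have \<beta>: "\<beta> i \<in> cfilt Y (- int r - int i) 1" for i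
    unfolding \<beta>_def using b1[of i]
    by (auto intro!: fc_hom_filt[OF v] simp: Q_complex_def Q_weight_def basis_def)
  note [simp] = Y.filt_in[OF \<alpha>] Y.filt_in[OF \<beta>]
  have d\<alpha>: "cdiff Y 0 (\<alpha> i) = \<beta> i \<oplus>\<^bsub>cobj Y 1\<^esub> \<beta> (Suc i)" for i
  proof -
    have "cdiff Y 0 (\<alpha> i) = v 1 (cdiff (Q_complex R r) 0 (basis R i))"
      using fc_hom_diff[OF v, of "basis R i" 0] b0 by (simp add: F \<alpha>_def)
    also have "\<dots> = \<beta> i \<oplus>\<^bsub>cobj Y 1\<^esub> \<beta> (Suc i)"
    proof (cases i)
      case 0
      then show ?thesis
        using linear_map.closed[OF V b1[of 1]] by (simp add: \<beta>_def Q_complex_diff_basis_0 is_cring)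
    next
      case (Suc j)
      then show ?thesis
        using linear_map.add[OF V b1[of i] b1[of "Suc i"]]
        by (simp add: \<beta>_def Q_complex_diff_basis is_cring F)
    qed
    finally show ?thesis .
  qed
  \<comment> \<open>The clause for \<open>i = 0\<close> pins down the start of the sequence, as
    \<open>Q_complex_hom\<close> asks for \<open>y 0\<close> to be zero.\<close>
  define P where "P i b \<longleftrightarrow> b \<in> cfilt X (- int r - int i) 1 \<and> cdiff X 1 b = \<zero>\<^bsub>cobj X 2\<^esub> \<and> f 1 b = \<beta> i
    \<and> (i = 0 \<longrightarrow> b = \<zero>\<^bsub>cobj X 1\<^esub>)" for i b
  \<comment> \<open>Only the cycles in degree one depend on earlier choices. The element
    \<open>x\<close> joins two consecutive ones, so it stays existential during the recursion and is
    chosen afterwards.\<close>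
  define S where "S i b x b' \<longleftrightarrow> x \<in> cfilt X (- int i) 0 \<and> f 0 x = \<alpha> i \<and>
    cdiff X 0 x = b \<oplus>\<^bsub>cobj X 1\<^esub> b'" for i b x b'
  have "\<exists>b'. P (Suc i) b' \<and> (\<exists>x. S i b x b')" if P: "P i b" for i b
  proof -
    have e: "- int i - int r = - int r - int i" "- int r - int i - 1 = - int r - int (Suc i)" by simp_all
    have b: "b \<in> cfilt X (- int i - int r) (0 + 1)" "cdiff X (0 + 1) b = \<zero>\<^bsub>cobj X (0 + 2)\<^esub>"
      "f (0 + 1) b = \<beta> i"
      using P unfolding e by (simp_all add: P_def)
    have "\<beta> (Suc i) \<in> cfilt Y (- int i - int r - 1) (0 + 1)"
      using \<beta>[of "Suc i"] unfolding e by simp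
    from lift_step[OF lift corr \<alpha> b(1,2) this] obtain x c
      where x: "x \<in> cfilt X (- int i) 0" "f 0 x = \<alpha> i" and c: "c \<in> cfilt X (- int i - int r - 1) 1"
        "f 1 c = \<beta> (Suc i)" and dx: "cdiff X 0 x = b \<oplus>\<^bsub>cobj X 1\<^esub> c"
      using b(3) d\<alpha> by auto
    have [simp]: "b \<in> carrier (cobj X 1)" "c \<in> carrier (cobj X 1)" using b(1) c(1) by auto
    \<comment> \<open>The conclusion of \<open>lift_step\<close> does not say that \<open>c\<close>
      is a cycle; this follows from \<open>d d x = 0\<close> and \<open>d b = 0\<close>.\<close>
    have "\<zero>\<^bsub>cobj X 2\<^esub> = cdiff X 1 (b \<oplus>\<^bsub>cobj X 1\<^esub> c)"
      using X.diff_diff[of x 0] x by (auto simp: dx)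
    also have "\<dots> = cdiff X 1 c"
      using X.D.add[of b 1 c] X.D.closed[of c 1] b(2) by simp
    finally have "cdiff X 1 c = \<zero>\<^bsub>cobj X 2\<^esub>" ..
    then have "P (Suc i) c" using c unfolding e by (simp add: P_def)
    moreover have "S i b x c" using x dx by (simp add: S_def)
    ultimately show ?thesis by blast
  qed
  moreover have "P 0 \<zero>\<^bsub>cobj X 1\<^esub>"
    using X.D.zero[of 1] F.zero[of 1] by (simp add: P_def \<beta>_def)
  ultimately obtain \<eta> where \<eta>: "\<And>i. P i (\<eta> i)" and "\<And>i. \<exists>x. S i (\<eta> i) x (\<eta> (Suc i))"
    using dependent_nat_choice[of P "\<lambda>i b b'. \<exists>x. S i b x b'"] by blast
  then obtain \<xi> where \<xi>: "\<And>i. S i (\<eta> i) (\<xi> i) (\<eta> (Suc i))" by metis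
  let ?h = "\<lambda>n c. if n = 0 then lincomb R (cobj X 0) \<xi> c else if n = 1 then lincomb R (cobj X 1) \<eta> c
      else \<zero>\<^bsub>cobj X n\<^esub>"
  have h: "?h \<in> fc_hom R (Q_complex R r) X"
    by (rule X.Q_complex_hom) (use \<eta> \<xi> in \<open>auto simp: P_def S_def\<close>)
  have in_X: "\<xi> i \<in> carrier (cobj X 0)" "\<eta> i \<in> carrier (cobj X 1)" for i
    using \<eta>[of i] \<xi>[of i] by (auto simp: P_def S_def)
  \<comment> \<open>In degrees zero and one both sides are combinations of the same vectors
    \<open>\<alpha>\<close> or \<open>\<beta>\<close>; in all other degrees the source is
    zero.\<close>
  have "f n (?h n c) = v n c" if "c \<in> carrier (cobj (Q_complex R r) n)" for n c
  proof -
    have c: "c \<in> carrier (free_module R (Q_index n))" using that by (simp add: F)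
    have vn: "v n \<in> linear_maps R (free_module R (Q_index n)) (cobj Y n)"
      using linear_map.linear[OF V] .
    note v_eq = linear_map_eq_lincomb[OF Y.M.module_axioms vn c]
    consider "n = 0" | "n = 1" | "n \<noteq> 0 \<and> n \<noteq> 1" by blast
    then show ?thesis
    proof cases
      case 1
      then have "f n (?h n c) = lincomb R (cobj Y 0) \<alpha> c"
        using F.lincomb_image[where x = \<xi>, OF c in_X(1)] \<xi> by (simp add: S_def)
      also have "\<dots> = v n c" unfolding v_eq unfolding 1 by (simp add: Q_index_def \<alpha>_def[abs_def])
      finally show ?thesis .
    next
      case 2
      then have "f n (?h n c) = lincomb R (cobj Y 1) \<beta> c"
        using F.lincomb_image[where x = \<eta>, OF c in_X(2)] \<eta> by (simp add: P_def)
      also have "\<dots> = v n c" unfolding v_eq unfolding 2 by (simp add: Q_index_def \<beta>_def[abs_def])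
      finally show ?thesis .
    next
      case 3
      then have "c = \<zero>\<^bsub>free_module R (Q_index n)\<^esub>"
        using c by (auto simp: free_module_def Q_index_def)
      then show ?thesis using 3 linear_map.zero[OF V] by simp
    qed
  qed
  \<comment> \<open>A linear map out of the zero module is zero, so \<open>u\<close> agrees with the
    lift there.\<close>
  moreover have "?h n \<zero>\<^bsub>cobj (Q_complex R r) n\<^esub> = u n a" if "a \<in> carrier (cobj (zero_complex R) n)" for n a
  proof -
    have "linear_map R (rank_one R False) (cobj X n) (u n)"
      using u filtered_complex_zero
      by (auto intro!: linear_map.intro linear_map_axioms.intro
          simp: X.M.module_axioms fc_hom_def zero_complex_def filtered_complex_def)
    moreover have "a = \<zero>\<^bsub>rank_one R False\<^esub>" using that by (simp add: zero_complex_def rank_one_def)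
    ultimately have "u n a = \<zero>\<^bsub>cobj X n\<^esub>" using linear_map.zero by blast
    then show ?thesis by (simp add: F free_module_def lincomb_def)
  qed
  ultimately show "\<exists>h\<in>fc_hom R (Q_complex R r) X.
      (\<forall>n. \<forall>a\<in>carrier (cobj (zero_complex R) n). h n \<zero>\<^bsub>cobj (Q_complex R r) n\<^esub> = u n a) \<and>
      (\<forall>n. \<forall>b\<in>carrier (cobj (Q_complex R r) n). f n (h n b) = v n b)"
    using h by (intro bexI[of _ ?h]) auto
qed

end

text \<open>The two claims concern differently described test maps. Both reduce to
  \<open>Q_complex_lifts\<close>, and only the source of \<open>corrects_cycles\<close>
  differs.\<close>

theorem lemma5p1p6:
  fixes R :: "('r, 'e) ring_scheme" and r :: nat and S :: "nat set"
  assumes "cring R"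
    and "S \<subseteq> {0..r}" and "r \<in> S"
  shows "cofibrant TYPE('x) TYPE('y) R r S (Q_complex R r)
    \<and> (\<forall>q :: ('r, 'x, 'y) fmor. acyclic_fibration R r S q
          \<longrightarrow> lifts_against R (from_zero R (Q_complex R r)) q)"
proof -
  interpret cring R by fact
  interpret Q: filtered_cx R "Q_complex R r"
    by unfold_locales (rule filtered_complex_Q)
  \<comment> \<open>Since \<open>r \<in> S\<close>, the maps in \<open>gen_J R r\<close> are among
    the generators, so both kinds of test map lift \<open>r\<close>-cycles.\<close>
  have J: "filtered_map R X Y f \<and> filtered_map.lifts_cycles X Y f r"
    if "injective_for R (\<Union>s\<in>S. gen_J R s) (X, Y, f)"
    for X :: "('r, 'x) fcomplex" and Y :: "('r, 'y) fcomplex" and f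
  proof
    show F: "filtered_map R X Y f"
      using that by (auto simp: injective_for_def intro: fc_morphism_imp_filtered_map[OF assms(1)])
    have "from_zero R (Z_complex R r p n) \<in> (\<Union>s\<in>S. gen_J R s)" for p n
      using assms(3) unfolding gen_J_def by blast
    with that show "filtered_map.lifts_cycles X Y f r"
      unfolding injective_for_def by (intro filtered_map.lifts_cycles_if_lifts[OF F]) blast
  qed
  have "lifts_against R (from_zero R (Q_complex R r)) q"
    if "acyclic_fibration R r S q" for q :: "('r, 'x, 'y) fmor"
  proof (cases q)
    case (fields X Y f)
    with that have "injective_for R (\<Union>s\<in>S. gen_J R s) (X, Y, f)" and qi: "quasi_iso R r (X, Y, f)"
      by (simp_all add: acyclic_fibration_def fibration_def)
    then interpret filtered_map R X Y f using J by blast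
    have "lifts_cycles r" using J that fields by (simp add: acyclic_fibration_def fibration_def)
    then show ?thesis
      unfolding fields using qi by (intro Q_complex_lifts corrects_cycles_if_quasi_iso)
  qed
  moreover have "lifts_against R (from_zero R (Q_complex R r)) q"
    if "I_S_injective R r S q" for q :: "('r, 'x, 'y) fmor"
  proof (cases q)
    case (fields X Y f)
    with that have J': "injective_for R (\<Union>s\<in>S. gen_J R s) (X, Y, f)"
      and I: "injective_for R (gen_I R r) (X, Y, f)"
      by (simp_all add: I_S_injective_def)
    then interpret filtered_map R X Y f using J by blast
    have "phi R (Suc r) p n \<in> gen_I R r" for p n
      unfolding gen_I_def Suc_eq_plus1 by blast
    with I have "corrects_cycles r"
      unfolding injective_for_def by (intro corrects_cycles_if_lifts) blast
    then show ?thesis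
      unfolding fields using J[OF J'] by (intro Q_complex_lifts) auto
  qed
  ultimately show ?thesis
    using Q.fc_morphism_from_zero by (auto simp: cofibrant_def cofibration_def)
qed

end
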